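(* Let $G$ be a finite group with $d(G)=2$. Then one of the following holds: (i) $G$ is generalized dihedral; (ii) $G$ admits an ORR; (iii) $G$ is isomorphic to one of $C_3\times C_3$, $C_4\times C_2$, $Q_8$, or the group $\langle a,b\mid a^4=b^4=(ab)^2=(ab^{-1})^2=1\rangle$ (of order $16$). Furthermore, the groups in (i) and (iii) admit no ORR.
   Context: $d(G)$ is the minimum cardinality of a generating set of $G$. $G$ is generalized dihedral if it contains an abelian subgroup $A$ of index $2$ and an element $\tau\in G\setminus A$ with $\tau^2=1$ and $\tau a\tau=a^{-1}$ for all $a\in A$. $Q_8$ is the quaternion group of order 8. The Cayley digraph $\mathrm{Cay}(G,S)$ has vertex set $G$ and arcs $(x,y)$ with $yx^{-1}\in S$. $G$ admits an ORR if there is $S\subseteq G$ with $S\cap S^{-1}=\emptyset$ and the full automorphism group of $\mathrm{Cay}(G,S)$ equal to the right regular representation of $G$. *)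

theory Defs
  imports "HOL-Algebra.Algebra" "Graph_Theory.Pair_Digraph"
begin

definition generating_number :: "('a, 'b) monoid_scheme \<Rightarrow> nat" where
  "generating_number G =
     (LEAST n. \<exists>S. S \<subseteq> carrier G \<and> finite S \<and> card S = n \<and> generate G S = carrier G)"

definition generalized_dihedral :: "('a, 'b) monoid_scheme \<Rightarrow> bool" where
  "generalized_dihedral G \<longleftrightarrow>
     (\<exists>A t. subgroup A G \<and> comm_group (G\<lparr>carrier := A\<rparr>) \<and> card (rcosets\<^bsub>G\<^esub> A) = 2 \<and>
        t \<in> carrier G - A \<and> t \<otimes>\<^bsub>G\<^esub> t = \<one>\<^bsub>G\<^esub> \<and>
        (\<forall>a\<in>A. t \<otimes>\<^bsub>G\<^esub> a \<otimes>\<^bsub>G\<^esub> t = inv\<^bsub>G\<^esub> a))"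


subsection \<open>Cayley digraphs and oriented regular representations\<close>

definition cayley_digraph :: "('a, 'b) monoid_scheme \<Rightarrow> 'a set \<Rightarrow> 'a pair_pre_digraph" where
  "cayley_digraph G S =
     \<lparr>pverts = carrier G,
      parcs = {(x, y). x \<in> carrier G \<and> y \<in> carrier G \<and> y \<otimes>\<^bsub>G\<^esub> inv\<^bsub>G\<^esub> x \<in> S}\<rparr>"

text \<open>
  Permutations of a set \<open>X\<close> are the elements of \<open>Bij X\<close>, i.e. they are extensional
  (\<open>undefined\<close> outside \<open>X\<close>). Sets of permutations can therefore be compared by equality.
\<close>

definition digraph_automorphisms :: "'a pair_pre_digraph \<Rightarrow> ('a \<Rightarrow> 'a) set" where
  "digraph_automorphisms D =
     {f \<in> Bij (pverts D). \<forall>x\<in>pverts D. \<forall>y\<in>pverts D. (x, y) \<in> parcs D \<longleftrightarrow> (f x, f y) \<in> parcs D}"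

definition right_regular_rep :: "('a, 'b) monoid_scheme \<Rightarrow> ('a \<Rightarrow> 'a) set" where
  "right_regular_rep G = (\<lambda>g. \<lambda>x\<in>carrier G. x \<otimes>\<^bsub>G\<^esub> g) ` carrier G"

definition admits_ORR :: "('a, 'b) monoid_scheme \<Rightarrow> bool" where
  "admits_ORR G \<longleftrightarrow>
     (\<exists>S \<subseteq> carrier G. S \<inter> m_inv G ` S = {} \<and>
        digraph_automorphisms (cayley_digraph G S) = right_regular_rep G)"

lemma (in group) right_regular_rep_subset_automorphisms:
  "right_regular_rep G \<subseteq> digraph_automorphisms (cayley_digraph G S)"
proof
  fix f assume "f \<in> right_regular_rep G"
  then obtain g where g: "g \<in> carrier G" and f: "f = (\<lambda>x\<in>carrier G. x \<otimes> g)"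
    by (auto simp: right_regular_rep_def)
  have "bij_betw f (carrier G) (carrier G)"
    by (rule bij_betwI[where g = "\<lambda>x. x \<otimes> inv g"]) (use g in \<open>auto simp: f m_assoc\<close>)
  moreover have "(y \<otimes> g) \<otimes> inv (x \<otimes> g) = y \<otimes> inv x"
    if "x \<in> carrier G" "y \<in> carrier G" for x y
  proof -
    have "(y \<otimes> g) \<otimes> inv (x \<otimes> g) = y \<otimes> (g \<otimes> (inv g \<otimes> inv x))"
      using that g by (simp add: inv_mult_group m_assoc)
    also have "g \<otimes> (inv g \<otimes> inv x) = inv x"
      using that g by (simp add: m_assoc[symmetric])
    finally show ?thesis .
  qed
  ultimately show "f \<in> digraph_automorphisms (cayley_digraph G S)"
    using g by (auto simp: digraph_automorphisms_def cayley_digraph_def Bij_def f)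
qed


subsection \<open>The quaternion group of order 8\<close>

text \<open>The tuple \<open>(w, x, y, z)\<close> stands for the quaternion \<open>w + xi + yj + zk\<close>.\<close>

fun hamilton_product ::
  "int \<times> int \<times> int \<times> int \<Rightarrow> int \<times> int \<times> int \<times> int \<Rightarrow> int \<times> int \<times> int \<times> int" where
  "hamilton_product (a, b, c, d) (w, x, y, z) =
     (a * w - b * x - c * y - d * z,
      a * x + b * w + c * z - d * y,
      a * y - b * z + c * w + d * x,
      a * z + b * y - c * x + d * w)"

definition quaternion_group :: "(int \<times> int \<times> int \<times> int) monoid" where
  "quaternion_group =
     \<lparr>carrier = {(1, 0, 0, 0), (-1, 0, 0, 0), (0, 1, 0, 0), (0, -1, 0, 0),
                 (0, 0, 1, 0), (0, 0, -1, 0), (0, 0, 0, 1), (0, 0, 0, -1)},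
      monoid.mult = hamilton_product,
      one = (1, 0, 0, 0)\<rparr>"

lemma hamilton_product_assoc:
  "hamilton_product (hamilton_product x y) z = hamilton_product x (hamilton_product y z)"
proof -
  obtain a b c d where x: "x = (a, b, c, d)" by (metis prod_cases4)
  obtain e f g h where y: "y = (e, f, g, h)" by (metis prod_cases4)
  obtain i j k l where z: "z = (i, j, k, l)" by (metis prod_cases4)
  show ?thesis unfolding x y z hamilton_product.simps prod.inject
    by (simp only: ring_distribs diff_conv_add_uminus mult_minus_left mult_minus_right minus_minus
        minus_add_distrib ac_simps)
qed

lemma group_quaternion_group: "group quaternion_group"
proof (rule groupI)
  fix x y z
  show "x \<otimes>\<^bsub>quaternion_group\<^esub> y \<otimes>\<^bsub>quaternion_group\<^esub> z =
      x \<otimes>\<^bsub>quaternion_group\<^esub> (y \<otimes>\<^bsub>quaternion_group\<^esub> z)"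
    by (simp add: quaternion_group_def hamilton_product_assoc)
next
  fix x y
  assume "x \<in> carrier quaternion_group" "y \<in> carrier quaternion_group"
  then show "x \<otimes>\<^bsub>quaternion_group\<^esub> y \<in> carrier quaternion_group"
    by (auto simp: quaternion_group_def)
next
  fix x
  assume "x \<in> carrier quaternion_group"
  then show "\<one>\<^bsub>quaternion_group\<^esub> \<otimes>\<^bsub>quaternion_group\<^esub> x = x"
    by (auto simp: quaternion_group_def)
next
  fix x
  assume "x \<in> carrier quaternion_group"
  then show "\<exists>y\<in>carrier quaternion_group. y \<otimes>\<^bsub>quaternion_group\<^esub> x = \<one>\<^bsub>quaternion_group\<^esub>"
    by (auto simp: quaternion_group_def)
qed (simp add: quaternion_group_def)


subsection \<open>Free groups and group presentations\<close>

text \<open>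
  Letters are pairs \<open>(x, e)\<close>: \<open>(x, True)\<close> is the generator \<open>x\<close> and \<open>(x, False)\<close> its formal inverse.
  The free group on the type \<open>'g\<close> consists of the words in these letters modulo insertion and
  deletion of mutually inverse adjacent letters.
\<close>

inductive free_eq :: "('g \<times> bool) list \<Rightarrow> ('g \<times> bool) list \<Rightarrow> bool" where
  cancel: "free_eq (u @ [(x, e), (x, \<not> e)] @ v) (u @ v)"
| refl: "free_eq u u"
| sym: "free_eq u v \<Longrightarrow> free_eq v u"
| trans: "free_eq u v \<Longrightarrow> free_eq v w \<Longrightarrow> free_eq u w"

definition free_class :: "('g \<times> bool) list \<Rightarrow> ('g \<times> bool) list set" where
  "free_class u = {v. free_eq u v}"

definition free_group :: "('g \<times> bool) list set monoid" where
  "free_group =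
     \<lparr>carrier = range free_class,
      monoid.mult = (\<lambda>U V. \<Union>u\<in>U. \<Union>v\<in>V. free_class (u @ v)),
      one = free_class []\<rparr>"

definition free_gen :: "'g \<Rightarrow> ('g \<times> bool) list set" where
  "free_gen x = free_class [(x, True)]"

definition normal_closure :: "('a, 'b) monoid_scheme \<Rightarrow> 'a set \<Rightarrow> 'a set" where
  "normal_closure G R = \<Inter>{N. N \<lhd> G \<and> R \<subseteq> N}"

text \<open>The group presented by all elements of the type \<open>'g\<close> as generators and the relators \<open>R\<close>.\<close>

definition presented_group ::
  "('g \<times> bool) list set set \<Rightarrow> ('g \<times> bool) list set set monoid" where
  "presented_group R = free_group Mod normal_closure free_group R"

lemma free_eq_append_left: "free_eq u v \<Longrightarrow> free_eq (w @ u) (w @ v)"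
proof (induction rule: free_eq.induct)
  case (cancel u x e v)
  show ?case using free_eq.cancel[of "w @ u" x e v] by simp
qed (blast intro: free_eq.refl free_eq.sym free_eq.trans)+

lemma free_eq_append_right: "free_eq u v \<Longrightarrow> free_eq (u @ w) (v @ w)"
proof (induction rule: free_eq.induct)
  case (cancel u x e v)
  show ?case using free_eq.cancel[of u x e "v @ w"] by simp
qed (blast intro: free_eq.refl free_eq.sym free_eq.trans)+

lemma free_eq_append: "free_eq u u' \<Longrightarrow> free_eq v v' \<Longrightarrow> free_eq (u @ v) (u' @ v')"
  by (meson free_eq.trans free_eq_append_left free_eq_append_right)

lemma free_class_eq_iff: "free_class u = free_class v \<longleftrightarrow> free_eq u v"
  unfolding free_class_def set_eq_iff mem_Collect_eq
  by (meson free_eq.refl free_eq.sym free_eq.trans)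

lemma free_group_mult:
  "free_class u \<otimes>\<^bsub>free_group\<^esub> free_class v = free_class (u @ v)"
proof -
  have *: "free_class (u' @ v') = free_class (u @ v)"
    if "u' \<in> free_class u" "v' \<in> free_class v" for u' v'
    using that unfolding free_class_eq_iff
    by (auto simp: free_class_def intro: free_eq_append free_eq.sym)
  have "u \<in> free_class u" "v \<in> free_class v"
    by (auto simp: free_class_def intro: free_eq.refl)
  then have "(\<Union>u'\<in>free_class u. \<Union>v'\<in>free_class v. free_class (u @ v)) = free_class (u @ v)"
    by blast
  then show ?thesis
    by (simp add: free_group_def * cong: SUP_cong)
qed

lemma free_eq_inverse: "free_eq (rev (map (\<lambda>(x, e). (x, \<not> e)) u) @ u) []"
proof (induction u)
  case Nil
  show ?case by (simp add: free_eq.refl)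
next
  case (Cons a u)
  obtain x e where a: "a = (x, e)" by (cases a)
  have "free_eq (rev (map (\<lambda>(x, e). (x, \<not> e)) u) @ [(x, \<not> e), (x, \<not> \<not> e)] @ u)
          (rev (map (\<lambda>(x, e). (x, \<not> e)) u) @ u)"
    by (rule free_eq.cancel)
  with Cons.IH show ?case
    by (simp add: a) (rule free_eq.trans)
qed

lemma group_free_group: "group (free_group :: ('g \<times> bool) list set monoid)"
proof (rule groupI)
  show "\<one>\<^bsub>free_group\<^esub> \<in> carrier (free_group :: ('g \<times> bool) list set monoid)"
    by (simp add: free_group_def)
next
  fix x y :: "('g \<times> bool) list set"
  assume "x \<in> carrier free_group" "y \<in> carrier free_group"
  then obtain u v where "x = free_class u" "y = free_class v"
    by (auto simp: free_group_def)
  then show "x \<otimes>\<^bsub>free_group\<^esub> y \<in> carrier free_group"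
    by (simp add: free_group_mult) (simp add: free_group_def)
next
  fix x y z :: "('g \<times> bool) list set"
  assume "x \<in> carrier free_group" "y \<in> carrier free_group" "z \<in> carrier free_group"
  then obtain u v w where "x = free_class u" "y = free_class v" "z = free_class w"
    by (auto simp: free_group_def)
  then show "x \<otimes>\<^bsub>free_group\<^esub> y \<otimes>\<^bsub>free_group\<^esub> z = x \<otimes>\<^bsub>free_group\<^esub> (y \<otimes>\<^bsub>free_group\<^esub> z)"
    by (simp add: free_group_mult)
next
  fix x :: "('g \<times> bool) list set"
  assume "x \<in> carrier free_group"
  then obtain u where x: "x = free_class u"
    by (auto simp: free_group_def)
  have one: "\<one>\<^bsub>free_group\<^esub> = free_class ([] :: ('g \<times> bool) list)"
    by (simp add: free_group_def)
  show "\<one>\<^bsub>free_group\<^esub> \<otimes>\<^bsub>free_group\<^esub> x = x"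
    by (simp add: x one free_group_mult)
  let ?y = "free_class (rev (map (\<lambda>(x, e). (x, \<not> e)) u))"
  have "?y \<otimes>\<^bsub>free_group\<^esub> x = \<one>\<^bsub>free_group\<^esub>"
    by (simp add: x one free_group_mult free_class_eq_iff free_eq_inverse)
  moreover have "?y \<in> carrier free_group"
    by (simp add: free_group_def)
  ultimately show "\<exists>y\<in>carrier free_group. y \<otimes>\<^bsub>free_group\<^esub> x = \<one>\<^bsub>free_group\<^esub>"
    by blast
qed

lemma (in group) normal_closure_normal:
  assumes "R \<subseteq> carrier G"
  shows "normal_closure G R \<lhd> G"
proof -
  have carr: "carrier G \<lhd> G"
    by (simp add: normal_inv_iff subgroup_self)
  have "subgroup (normal_closure G R) G"
    unfolding normal_closure_def
    by (rule subgroups_Inter) (use carr assms in \<open>auto intro: normal_imp_subgroup\<close>)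
  then show ?thesis
    unfolding normal_inv_iff by (auto simp: normal_closure_def normal_inv_iff)
qed

lemma group_presented_group:
  "R \<subseteq> carrier free_group \<Longrightarrow> group (presented_group R)"
  unfolding presented_group_def
  by (intro normal.factorgroup_is_group group.normal_closure_normal group_free_group)

datatype two_gens = gen_a | gen_b

definition exceptional_group_16 :: "(two_gens \<times> bool) list set set monoid" where
  "exceptional_group_16 =
     (let F = free_group; a = free_gen gen_a; b = free_gen gen_b in
        presented_group
          {a [^]\<^bsub>F\<^esub> (4::nat), b [^]\<^bsub>F\<^esub> (4::nat),
           (a \<otimes>\<^bsub>F\<^esub> b) [^]\<^bsub>F\<^esub> (2::nat), (a \<otimes>\<^bsub>F\<^esub> inv\<^bsub>F\<^esub> b) [^]\<^bsub>F\<^esub> (2::nat)})"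

lemma group_exceptional_group_16: "group exceptional_group_16"
proof -
  interpret F: group "free_group :: (two_gens \<times> bool) list set monoid"
    by (rule group_free_group)
  have "free_gen x \<in> carrier free_group" for x :: two_gens
    by (simp add: free_gen_def free_group_def)
  then show ?thesis
    by (auto simp: exceptional_group_16_def Let_def intro!: group_presented_group)
qed

end

theory Submission
  imports Defs
begin

text \<open>
  A connected Cayley digraph is an ORR as soon as the subdigraph induced on its connection set \<open>S\<close>
  has no nontrivial automorphism: an automorphism fixing a vertex \<open>x\<close> then fixes all
  out-neighbours of \<open>x\<close>, hence everything.

  A group with \<open>d(G) = 2\<close> that is not generalized dihedral is generated by two non-involutions
  \<open>a\<close>, \<open>b\<close>. For nonabelian \<open>G\<close> the set \<open>{a, b, ba}\<close> is rigid unless \<open>ba\<close> is an involution or \<open>G\<close> is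
  the quaternion group. Replacing \<open>a\<close> by its inverse, we are left with \<open>(ab)\<^sup>2 = (ab\<^sup>-\<^sup>1)\<^sup>2 = 1\<close>; here
  \<open>{a, a\<^sup>2, b}\<close> is rigid if \<open>a\<close> has order at least 5, and otherwise \<open>G\<close> is the exceptional group of
  order 16. The same set settles all abelian groups but three, and \<open>{a, b, ab, ab\<^sup>2}\<close> settles
  \<open>C\<^sub>4 \<times> C\<^sub>4\<close>.

  Conversely, in a generalized dihedral group every admissible \<open>S\<close> lies in the abelian subgroup, so
  the digraph is disconnected, and in each of the four listed groups every \<open>S\<close> with
  \<open>S \<inter> S\<^sup>-\<^sup>1 = \<emptyset>\<close> is invariant under a nontrivial group automorphism.
\<close>

section \<open>Rigid connection sets\<close>

text \<open>No case for inverses arises: in a finite group left multiplication by \<open>s\<close>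
  maps the set where \<open>P\<close> holds injectively into itself, hence onto itself, so
  \<open>inv s\<close> preserves that set as well.\<close>

lemma (in group) generate_left_induct [consumes 3, case_names one mult]:
  assumes y: "y \<in> generate G S" and S: "S \<subseteq> carrier G" and fin: "finite (carrier G)"
    and one: "P \<one>"
    and mult: "\<And>s x. s \<in> S \<Longrightarrow> x \<in> carrier G \<Longrightarrow> P x \<Longrightarrow> P (s \<otimes> x)"
  shows "P y"
proof -
  let ?F = "{x \<in> carrier G. P x}"
  have inv: "P (inv s \<otimes> x)" if s: "s \<in> S" and x: "x \<in> carrier G" "P x" for s x
  proof -
    have sc: "s \<in> carrier G" using s S by auto
    have "(\<lambda>x. s \<otimes> x) ` ?F = ?F"
    proof (rule endo_inj_surj)
      show "finite ?F" using fin by simp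
      show "(\<lambda>x. s \<otimes> x) ` ?F \<subseteq> ?F" using mult s sc by auto
      show "inj_on (\<lambda>x. s \<otimes> x) ?F" using sc by (auto intro!: inj_onI)
    qed
    then obtain x' where "x' \<in> ?F" "x = s \<otimes> x'" using x by blast
    then show ?thesis using sc by (simp add: m_assoc[symmetric])
  qed
  \<comment> \<open>The rule \<open>eng\<close> multiplies two arbitrary members of
    \<open>generate G S\<close>, so the induction runs over all multipliers that preserve
    \<open>P\<close>; the claim is then the case \<open>x = \<one>\<close>.\<close>
  from y have "\<forall>x\<in>carrier G. P x \<longrightarrow> P (y \<otimes> x)"
  proof induction
    case (eng h1 h2)
    then have "h1 \<in> carrier G" "h2 \<in> carrier G"
      using generate_in_carrier S by blast+
    then show ?case using eng by (auto simp: m_assoc)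
  qed (use mult inv in auto)
  moreover have "y \<in> carrier G" using y S generate_in_carrier by blast
  ultimately show ?thesis using one by force
qed

lemma (in group) generate_eq_carrierI:
  assumes "generate G S = carrier G" "T \<subseteq> carrier G" "S \<subseteq> generate G T"
  shows "generate G T = carrier G"
  using assms generate_subgroup_incl[OF assms(3) generate_is_subgroup[OF assms(2)]]
    generate_incl[OF assms(2)] by auto

text \<open>The out-neighbourhood of each vertex is a right translate of \<open>S\<close>. An
  automorphism that agrees with right translation by \<open>c\<close> at \<open>x\<close> permutes
  the labels of the arcs leaving \<open>x\<close>, and \<open>rigid\<close> makes this permutation
  trivial, so the agreement spreads from \<open>\<one>\<close> along the generators. The hypothesis
  \<open>oriented\<close> includes \<open>s = t\<close> and so keeps \<open>\<one>\<close> and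
  involutions out of \<open>S\<close>.\<close>

lemma (in group) admits_ORR_if_rigid:
  assumes fin: "finite (carrier G)" and S: "S \<subseteq> carrier G" and gen: "generate G S = carrier G"
    and oriented: "\<And>s t. s \<in> S \<Longrightarrow> t \<in> S \<Longrightarrow> s \<otimes> t \<noteq> \<one>"
    and rigid: "\<And>f. bij_betw f S S \<Longrightarrow>
       (\<And>x y. x \<in> S \<Longrightarrow> y \<in> S \<Longrightarrow> (\<exists>s\<in>S. y = s \<otimes> x) \<longleftrightarrow> (\<exists>s\<in>S. f y = s \<otimes> f x)) \<Longrightarrow>
       (\<And>x. x \<in> S \<Longrightarrow> f x = x)"
  shows "admits_ORR G"
  unfolding admits_ORR_def
proof (intro exI[of _ S] conjI)
  show "S \<inter> m_inv G ` S = {}"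
    using oriented S by (auto simp: subset_iff) (metis r_inv)
  show "digraph_automorphisms (cayley_digraph G S) = right_regular_rep G"
  proof (intro equalityI right_regular_rep_subset_automorphisms subsetI)
    have arc: "y \<otimes> inv x \<in> S \<longleftrightarrow> (\<exists>s\<in>S. y = s \<otimes> x)" if "x \<in> carrier G" "y \<in> carrier G" for x y
      using that S by (metis inv_solve_right' subsetD)
    fix h assume h: "h \<in> digraph_automorphisms (cayley_digraph G S)"
    have hbij: "bij_betw h (carrier G) (carrier G)" and hext: "h \<in> extensional (carrier G)"
      using h by (auto simp: digraph_automorphisms_def cayley_digraph_def Bij_def)
    have hcl: "h x \<in> carrier G" if "x \<in> carrier G" for x
      using hbij that by (auto simp: bij_betw_def)
    have harc: "(\<exists>s\<in>S. y = s \<otimes> x) \<longleftrightarrow> (\<exists>s\<in>S. h y = s \<otimes> h x)"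
      if "x \<in> carrier G" "y \<in> carrier G" for x y
      using h that hcl arc by (simp add: digraph_automorphisms_def cayley_digraph_def)
    define c where "c = h \<one>"
    have c: "c \<in> carrier G" unfolding c_def by (simp add: hcl)
    have step: "h (s \<otimes> x) = s \<otimes> x \<otimes> c"
      if x: "x \<in> carrier G" and hx: "h x = x \<otimes> c" and s: "s \<in> S" for s x
    proof -
      \<comment> \<open>The out-neighbours of \<open>x\<close> are the \<open>t \<otimes> x\<close>,
        those of \<open>h x\<close> the \<open>t \<otimes> (x \<otimes> c)\<close>; \<open>f\<close>
        is the action of \<open>h\<close> on the labels \<open>t\<close>.\<close>
      define f where "f t = h (t \<otimes> x) \<otimes> inv (x \<otimes> c)" for t
      have xc: "x \<otimes> c \<in> carrier G" using x c by simp
      have hf: "h (t \<otimes> x) = f t \<otimes> (x \<otimes> c)" and fcl: "f t \<in> carrier G" if "t \<in> carrier G" for t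
        using that x xc hcl by (simp_all add: f_def m_assoc)
      have fS: "f t \<in> S" if t: "t \<in> S" for t
      proof -
        have tc: "t \<in> carrier G" using t S by auto
        obtain u where "u \<in> S" "h (t \<otimes> x) = u \<otimes> (x \<otimes> c)"
          using harc[of x "t \<otimes> x"] t tc x hx by auto
        then show ?thesis using hf[OF tc] fcl[OF tc] xc S by auto
      qed
      have "inj_on f S"
      proof (rule inj_onI)
        fix t u assume tu: "t \<in> S" "u \<in> S" "f t = f u"
        then have "t \<in> carrier G" "u \<in> carrier G" using S by auto
        moreover from this have "h (t \<otimes> x) = h (u \<otimes> x)" using hf tu by simp
        ultimately show "t = u" using hbij x unfolding bij_betw_def
          by (metis inj_onD m_closed r_cancel)
      qed
      then have fbij: "bij_betw f S S"
        using fS endo_inj_surj[of S f] finite_subset[OF S fin] by (auto simp: bij_betw_def)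
      have "(\<exists>s\<in>S. u = s \<otimes> t) \<longleftrightarrow> (\<exists>s\<in>S. f u = s \<otimes> f t)" if tu: "t \<in> S" "u \<in> S" for t u
      proof -
        have tc: "t \<in> carrier G" and uc: "u \<in> carrier G" using tu S by auto
        have "(\<exists>s\<in>S. u = s \<otimes> t) \<longleftrightarrow> (\<exists>s\<in>S. u \<otimes> x = s \<otimes> (t \<otimes> x))"
          using S tc uc x by (intro bex_cong) (auto simp: subset_iff simp flip: m_assoc)
        also have "\<dots> \<longleftrightarrow> (\<exists>s\<in>S. f u \<otimes> (x \<otimes> c) = s \<otimes> (f t \<otimes> (x \<otimes> c)))"
          using harc[of "t \<otimes> x" "u \<otimes> x"] tc uc x by (simp add: hf)
        also have "\<dots> \<longleftrightarrow> (\<exists>s\<in>S. f u = s \<otimes> f t)"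
          using S fcl tc uc x c by (intro bex_cong) (auto simp: subset_iff simp flip: m_assoc)
        finally show ?thesis .
      qed
      then have "f s = s" using rigid[OF fbij] s by blast
      then show ?thesis using hf[of s] s S x c by (auto simp: m_assoc)
    qed
    have "h x = x \<otimes> c" if "x \<in> carrier G" for x
    proof -
      have "x \<in> generate G S" using that gen by simp
      from this S fin show ?thesis
      proof (induction rule: generate_left_induct)
        case one
        then show ?case using c by (simp add: c_def)
      qed (rule step)
    qed
    then have "h = (\<lambda>x\<in>carrier G. x \<otimes> c)"
      using hext by (auto simp: extensional_def)
    then show "h \<in> right_regular_rep G" using c by (auto simp: right_regular_rep_def)
  qed
qed (rule S)

section \<open>Membership of products in subgroups, and small digraphs without symmetry\<close>

lemma (in group) subgroup_mult_mem_iff: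
  assumes "subgroup H G" "h \<in> H" "x \<in> carrier G"
  shows "h \<otimes> x \<in> H \<longleftrightarrow> x \<in> H" "x \<otimes> h \<in> H \<longleftrightarrow> x \<in> H"
proof -
  have h: "h \<in> carrier G" "inv h \<in> H" using assms by (auto intro: subgroup.mem_carrier subgroup.m_inv_closed)
  have "x = inv h \<otimes> (h \<otimes> x)" "x = (x \<otimes> h) \<otimes> inv h"
    using h assms by (simp_all add: m_assoc flip: m_assoc[of "inv h"])
  then show "h \<otimes> x \<in> H \<longleftrightarrow> x \<in> H" "x \<otimes> h \<in> H \<longleftrightarrow> x \<in> H"
    using assms h by (metis subgroup.m_closed)+
qed

lemma (in group) arcs_antisym:
  assumes "S \<subseteq> carrier G" and "\<And>s t. s \<in> S \<Longrightarrow> t \<in> S \<Longrightarrow> s \<otimes> t \<noteq> \<one>"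
    and "\<exists>s\<in>S. y = s \<otimes> x" "\<exists>t\<in>S. x = t \<otimes> y" "y \<in> carrier G"
  shows False
proof -
  obtain s t where st: "s \<in> S" "t \<in> S" "y = s \<otimes> x" "x = t \<otimes> y" using assms by auto
  have c: "s \<in> carrier G" "t \<in> carrier G" using st assms(1) by auto
  have "s \<otimes> t \<otimes> y = y" using c st assms(5) by (metis m_assoc)
  then have "s \<otimes> t = \<one>" using c assms(5) by simp
  then show False using assms(2) st by blast
qed

text \<open>Besides the arc from \<open>a\<close> to \<open>c\<close>, only the arcs
  \<open>b\<close> to \<open>a\<close> and \<open>c\<close> to \<open>b\<close> can occur, and not
  both. This leaves one arc with an isolated vertex or a directed path, both rigid; with both arcs
  present there would be a directed triangle, which can be rotated.\<close>

lemma rigid_on_three: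
  assumes f: "bij_betw f {a, b, c} {a, b, c}" and distinct: "a \<noteq> b" "a \<noteq> c" "b \<noteq> c"
    and R: "\<And>x y. x \<in> {a, b, c} \<Longrightarrow> y \<in> {a, b, c} \<Longrightarrow> R x y \<longleftrightarrow> R (f x) (f y)"
    and "R a c" "\<not> R c a" "\<not> R a b" "\<not> R b c" "\<not> (R b a \<and> R c b)"
    and x: "x \<in> {a, b, c}"
  shows "f x = x"
proof -
  have mem: "f a \<in> {a, b, c}" "f b \<in> {a, b, c}" "f c \<in> {a, b, c}"
    using bij_betw_apply[OF f] by blast+
  have neq: "f a \<noteq> f b" "f a \<noteq> f c" "f b \<noteq> f c"
    using bij_betw_imp_inj_on[OF f] distinct by (auto dest: inj_onD)
  have "f a = a \<and> f b = b \<and> f c = c"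
    using mem neq assms(6-10) R[of a b] R[of a c] R[of b a] R[of b c] R[of c a] R[of c b] distinct
    by (smt (verit) insert_iff empty_iff)
  then show ?thesis using x by auto
qed

text \<open>Apart from loops, the pairs of out-degree and in-degree of \<open>a\<close>,
  \<open>b\<close>, \<open>c\<close>, \<open>d\<close> are (1,0), (2,0), (1,2) and (0,2), all
  different.\<close>

lemma rigid_on_four:
  assumes f: "bij_betw f {a, b, c, d} {a, b, c, d}"
    and distinct: "a \<noteq> b" "a \<noteq> c" "a \<noteq> d" "b \<noteq> c" "b \<noteq> d" "c \<noteq> d"
    and R: "\<And>x y. x \<in> {a, b, c, d} \<Longrightarrow> y \<in> {a, b, c, d} \<Longrightarrow> R x y \<longleftrightarrow> R (f x) (f y)"
    and arcs: "R b c" "R b d" "R a c" "R c d"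
      "\<not> R a b" "\<not> R b a" "\<not> R a d" "\<not> R d a" "\<not> R c b" "\<not> R d b" "\<not> R c a" "\<not> R d c"
    and x: "x \<in> {a, b, c, d}"
  shows "f x = x"
proof -
  have mem: "f a \<in> {a, b, c, d}" "f b \<in> {a, b, c, d}" "f c \<in> {a, b, c, d}" "f d \<in> {a, b, c, d}"
    using bij_betw_apply[OF f] by blast+
  have neq: "f a \<noteq> f b" "f a \<noteq> f c" "f a \<noteq> f d" "f b \<noteq> f c" "f b \<noteq> f d" "f c \<noteq> f d"
    using bij_betw_imp_inj_on[OF f] distinct by (auto dest: inj_onD)
  have "f a = a \<and> f b = b \<and> f c = c \<and> f d = d"
    using mem neq arcs R[of b c] R[of b d] R[of a c] R[of c d] R[of a b] R[of b a] R[of a d] R[of d a]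
    by (smt (verit) insert_iff empty_iff)
  then show ?thesis using x by auto
qed

text \<open>The form in which d(G) = 2 enters: two elements generate and no single one does. As a
  locale it can be interpreted again for other generating pairs of the same group, such as
  \<open>a \<otimes> b\<close>, \<open>b\<close> or \<open>inv a\<close>, \<open>b\<close>.\<close>

locale noncyclic_pair = group +
  fixes a b
  assumes fin: "finite (carrier G)"
    and a [simp]: "a \<in> carrier G" and b [simp]: "b \<in> carrier G"
    and gen: "generate G {a, b} = carrier G"
    and noncyclic: "\<And>x. x \<in> carrier G \<Longrightarrow> generate G {x} \<noteq> carrier G"
begin

section \<open>Changes of the generating pair and the cyclic subgroups of the two generators\<close>

lemma noncyclic_pairI:
  assumes "x \<in> carrier G" "y \<in> carrier G" "a \<in> generate G {x, y}" "b \<in> generate G {x, y}"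
  shows "noncyclic_pair G x y"
  using assms fin noncyclic generate_eq_carrierI[OF gen, of "{x, y}"]
  by unfold_locales auto

lemma swapped: "noncyclic_pair G b a"
  by (rule noncyclic_pairI) (auto intro: generate.incl)

lemma pair_mult: "noncyclic_pair G (a \<otimes> b) b"
proof (rule noncyclic_pairI)
  have "(a \<otimes> b) \<otimes> inv b \<in> generate G {a \<otimes> b, b}"
    by (intro generate.eng generate.incl generate.inv) auto
  then show "a \<in> generate G {a \<otimes> b, b}" by (simp add: m_assoc)
qed (auto intro: generate.incl)

lemma pair_inv: "noncyclic_pair G (inv a) b"
proof (rule noncyclic_pairI)
  have "inv (inv a) \<in> generate G {inv a, b}"
    by (intro generate.inv) auto
  then show "a \<in> generate G {inv a, b}" by simp
qed (auto intro: generate.incl)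

lemma powers_subgroups: "subgroup (generate G {a}) G" "subgroup (generate G {b}) G"
  by (simp_all add: generate_is_subgroup)

lemma mem_powers: "a \<in> generate G {a}" "b \<in> generate G {b}"
  "\<one> \<in> generate G {a}" "\<one> \<in> generate G {b}"
  by (simp_all add: generate.incl generate.one)

lemma not_mem_powers: "a \<notin> generate G {b}" "b \<notin> generate G {a}"
proof -
  have False if "{a, b} \<subseteq> generate G {x}" "x \<in> {a, b}" for x
    using that generate_eq_carrierI[OF gen, of "{x}"] noncyclic[of x] by auto
  then show "a \<notin> generate G {b}" "b \<notin> generate G {a}" using mem_powers by blast+
qed

lemmas powers_mult_mem_iff =
  subgroup_mult_mem_iff[OF powers_subgroups(1)] subgroup_mult_mem_iff[OF powers_subgroups(2)]

text \<open>Most inequalities between words are obtained this way: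
  \<open>powers_mult_mem_iff\<close> strips letters from the ends of a word, and
  \<open>not_mem_powers\<close> decides membership of what remains.\<close>

lemma neq_if_powers:
  assumes "(x \<in> generate G {a}) \<noteq> (y \<in> generate G {a}) \<or> (x \<in> generate G {b}) \<noteq> (y \<in> generate G {b})"
  shows "x \<noteq> y"
  using assms by blast

text \<open>The connection set is \<open>{a, b, b \<otimes> a}\<close>. Failure of
  \<open>not_both\<close> is the quaternion case, treated in
  \<open>iso_quaternion_group\<close>.\<close>

lemma admits_ORR_two_and_product:
  assumes "a \<otimes> a \<noteq> \<one>" "b \<otimes> b \<noteq> \<one>" "b \<otimes> a \<otimes> (b \<otimes> a) \<noteq> \<one>" "a \<otimes> b \<noteq> b \<otimes> a"
    and not_both: "b \<otimes> a \<otimes> b \<noteq> a \<or> a \<otimes> b \<otimes> a \<noteq> b"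
  shows "admits_ORR G"
proof (rule admits_ORR_if_rigid[OF fin])
  note pw = powers_mult_mem_iff mem_powers not_mem_powers
  let ?c = "b \<otimes> a"
  let ?S = "{a, b, ?c}"
  show "generate G ?S = carrier G"
    by (rule generate_eq_carrierI[OF gen]) (auto intro: generate.incl)
  have distinct: "a \<noteq> b" "a \<noteq> ?c" "b \<noteq> ?c"
    by (rule neq_if_powers; simp add: pw)+
  have n1: "a \<otimes> b \<noteq> \<one>" "b \<otimes> a \<noteq> \<one>" "a \<otimes> ?c \<noteq> \<one>" "?c \<otimes> a \<noteq> \<one>"
    "b \<otimes> ?c \<noteq> \<one>" "?c \<otimes> b \<noteq> \<one>"
    by (rule neq_if_powers; simp add: pw)+
  show oriented: "s \<otimes> t \<noteq> \<one>" if "s \<in> ?S" "t \<in> ?S" for s t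
    using that n1 assms by auto
  define R where "R x y \<longleftrightarrow> (\<exists>s\<in>?S. y = s \<otimes> x)" for x y
  note antisym = arcs_antisym[OF _ oriented, of ?S, folded R_def]
  \<comment> \<open>Only the arcs from \<open>b\<close> to \<open>a\<close> and from
    \<open>?c\<close> to \<open>b\<close> depend on further relations; together with the arc from
    \<open>a\<close> to \<open>?c\<close> they would close a directed triangle.\<close>
  have R: "R a ?c" "\<not> R ?c a" "\<not> R a b" "\<not> R b ?c"
    "R b a \<longleftrightarrow> b \<otimes> a \<otimes> b = a" "R ?c b \<longleftrightarrow> a \<otimes> b \<otimes> a = b"
  proof -
    show "R a ?c" by (simp add: R_def)
    then show "\<not> R ?c a" using antisym[of a ?c] by auto
    have "b \<noteq> a \<otimes> a" "b \<noteq> b \<otimes> a" by (rule neq_if_powers; simp add: pw)+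
    then show "\<not> R a b" using assms by (simp add: R_def m_assoc)
    have "b \<noteq> \<one>" using assms by auto
    then show "\<not> R b ?c" using assms distinct by (simp add: R_def)
    have "a \<noteq> a \<otimes> b" "a \<noteq> b \<otimes> b" by (rule neq_if_powers; simp add: pw)+
    then show "R b a \<longleftrightarrow> b \<otimes> a \<otimes> b = a" by (auto simp: R_def)
    show "R ?c b \<longleftrightarrow> a \<otimes> b \<otimes> a = b" using n1 by (auto simp: R_def m_assoc)
  qed
  show "f x = x" if f: "bij_betw f ?S ?S" and x: "x \<in> ?S"
    and arcs: "\<And>x y. x \<in> ?S \<Longrightarrow> y \<in> ?S \<Longrightarrow> (\<exists>s\<in>?S. y = s \<otimes> x) \<longleftrightarrow> (\<exists>s\<in>?S. f y = s \<otimes> f x)"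
    for f x
    using rigid_on_three[OF f distinct arcs[folded R_def] R(1-4) _ x] not_both R(5,6) by blast
qed auto

text \<open>In the connection set \<open>{a, b, a \<otimes> a}\<close> the only arc goes from
  \<open>a\<close> to its square. The conditions on powers of \<open>a\<close> say that its order is
  at least 5, which keeps \<open>a\<close> and its square oriented; the last one excludes an arc
  from \<open>b\<close> to the square of \<open>a\<close>.\<close>

lemma admits_ORR_two_and_square:
  assumes "a \<otimes> a \<noteq> \<one>" "a \<otimes> a \<otimes> a \<noteq> \<one>" "a \<otimes> a \<otimes> (a \<otimes> a) \<noteq> \<one>"
    and "b \<otimes> b \<noteq> \<one>" "a \<otimes> a \<noteq> b \<otimes> b"
  shows "admits_ORR G"
proof (rule admits_ORR_if_rigid[OF fin])
  note pw = powers_mult_mem_iff mem_powers not_mem_powers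
  let ?c = "a \<otimes> a"
  let ?S = "{a, b, ?c}"
  show "generate G ?S = carrier G"
    by (rule generate_eq_carrierI[OF gen]) (auto intro: generate.incl)
  have one: "a \<noteq> \<one>" "b \<noteq> \<one>" using assms by auto
  have "a \<noteq> b" "b \<noteq> ?c" by (rule neq_if_powers; simp add: pw)+
  with one have distinct: "a \<noteq> b" "a \<noteq> ?c" "b \<noteq> ?c" by auto
  have "a \<otimes> b \<noteq> \<one>" "b \<otimes> a \<noteq> \<one>" "b \<otimes> ?c \<noteq> \<one>" "?c \<otimes> b \<noteq> \<one>"
    by (rule neq_if_powers; simp add: pw)+
  then show oriented: "s \<otimes> t \<noteq> \<one>" if "s \<in> ?S" "t \<in> ?S" for s t
    using that assms by (auto simp: m_assoc)
  define R where "R x y \<longleftrightarrow> (\<exists>s\<in>?S. y = s \<otimes> x)" for x y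
  note antisym = arcs_antisym[OF _ oriented, of ?S, folded R_def]
  have R: "R a ?c" "\<not> R ?c a" "\<not> R a b" "\<not> R b ?c" "\<not> R b a"
  proof -
    show "R a ?c" by (simp add: R_def)
    then show "\<not> R ?c a" using antisym[of a ?c] by auto
    have "b \<noteq> ?c \<otimes> a" by (rule neq_if_powers; simp add: pw)
    then show "\<not> R a b" using distinct one by (simp add: R_def)
    show "\<not> R b ?c" using assms distinct one by (simp add: R_def)
    have "a \<noteq> b \<otimes> b" by (rule neq_if_powers; simp add: pw)
    moreover have "a \<otimes> b \<noteq> \<one>" by (rule neq_if_powers; simp add: pw)
    ultimately show "\<not> R b a" using one by (simp add: R_def m_assoc)
  qed
  show "f x = x" if f: "bij_betw f ?S ?S" and x: "x \<in> ?S"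
    and arcs: "\<And>x y. x \<in> ?S \<Longrightarrow> y \<in> ?S \<Longrightarrow> (\<exists>s\<in>?S. y = s \<otimes> x) \<longleftrightarrow> (\<exists>s\<in>?S. f y = s \<otimes> f x)"
    for f x
    using rigid_on_three[OF f distinct arcs[folded R_def] R(1-4) _ x] R(5) by blast
qed auto

text \<open>For \<open>a\<close> of order 4 the square is an involution and cannot be in a
  connection set, so \<open>{a, b, ab, ab^2}\<close> is used. Its arcs are \<open>b\<close> to
  \<open>ab\<close>, \<open>b\<close> to \<open>ab^2\<close>, \<open>a\<close> to \<open>ab\<close>
  and \<open>ab\<close> to \<open>ab^2\<close>, the digraph of \<open>rigid_on_four\<close>.\<close>

lemma admits_ORR_C4_times_C4:
  assumes comm: "b \<otimes> a = a \<otimes> b" and "a \<otimes> a \<noteq> \<one>" "b \<otimes> b \<noteq> \<one>"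
    and b4: "b \<otimes> (b \<otimes> (b \<otimes> b)) = \<one>" and "a \<otimes> (a \<otimes> (b \<otimes> b)) \<noteq> \<one>"
  shows "admits_ORR G"
proof (rule admits_ORR_if_rigid[OF fin])
  note pw = powers_mult_mem_iff mem_powers not_mem_powers
  have comm': "b \<otimes> (a \<otimes> x) = a \<otimes> (b \<otimes> x)" if "x \<in> carrier G" for x
    using comm that by (metis a b m_assoc)
  let ?c = "a \<otimes> b" and ?d = "a \<otimes> (b \<otimes> b)"
  let ?S = "{a, b, ?c, ?d}"
  note nf = m_assoc comm comm' b4
  show "generate G ?S = carrier G"
    by (rule generate_eq_carrierI[OF gen]) (auto intro: generate.incl)
  have one: "a \<noteq> \<one>" "b \<noteq> \<one>" using assms by auto
  have ne: "a \<noteq> b" "b \<noteq> a \<otimes> a" "a \<noteq> b \<otimes> b" "a \<otimes> b \<noteq> \<one>" "a \<otimes> (a \<otimes> b) \<noteq> \<one>"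
    "a \<otimes> (b \<otimes> b) \<noteq> \<one>" "a \<otimes> (b \<otimes> (b \<otimes> b)) \<noteq> \<one>"
    by (rule neq_if_powers; simp add: pw)+
  have b3: "b \<otimes> (b \<otimes> b) \<noteq> \<one>" using b4 one by auto
  \<comment> \<open>Stripping letters does not decide this word. Multiplication by \<open>b\<close>
    and \<open>b4\<close> would turn the equation into \<open>a \<otimes> a = b\<close>, which is
    impossible.\<close>
  have a2b3: "a \<otimes> (a \<otimes> (b \<otimes> (b \<otimes> b))) \<noteq> \<one>"
  proof
    assume "a \<otimes> (a \<otimes> (b \<otimes> (b \<otimes> b))) = \<one>"
    then have "a \<otimes> (a \<otimes> (b \<otimes> (b \<otimes> b))) \<otimes> b = b" by simp
    then show False using ne by (simp add: nf)
  qed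
  have "b \<noteq> ?d" using ne by (simp flip: m_assoc)
  moreover have "a \<noteq> ?c" "a \<noteq> ?d" "b \<noteq> ?c" "?c \<noteq> ?d" using one assms(2,3) by simp_all
  moreover note ne(1)
  ultimately have distinct: "a \<noteq> b" "a \<noteq> ?c" "a \<noteq> ?d" "b \<noteq> ?c" "b \<noteq> ?d" "?c \<noteq> ?d" by auto
  show oriented: "s \<otimes> t \<noteq> \<one>" if "s \<in> ?S" "t \<in> ?S" for s t
    using that assms(2,3,5) ne a2b3 by (elim insertE emptyE) (simp_all add: nf)
  define R where "R x y \<longleftrightarrow> (\<exists>s\<in>?S. y = s \<otimes> x)" for x y
  note antisym = arcs_antisym[OF _ oriented, of ?S, folded R_def]
  have R: "R b ?c" "R b ?d" "R a ?c" "R ?c ?d"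
    by (simp_all add: R_def nf)
  have nR1: "\<not> R a b"
  proof -
    have "b \<noteq> a \<otimes> (a \<otimes> b)" "b \<noteq> a \<otimes> (a \<otimes> (b \<otimes> b))"
      using assms(2) ne by (simp_all flip: m_assoc)
    then show ?thesis using one ne by (simp add: R_def nf)
  qed
  have nR2: "\<not> R b a" using assms(3) one ne b3 by (simp add: R_def nf)
  have nR3: "\<not> R a ?d" using one ne by (auto simp add: R_def nf)
  have nR4: "\<not> R ?d a" using one ne b3 by (simp add: R_def nf)
  have nR5: "\<not> R ?c b" "\<not> R ?d b" "\<not> R ?c a" "\<not> R ?d ?c"
    using antisym[of b ?c] antisym[of b ?d] antisym[of a ?c] antisym[of ?c ?d] R by auto
  show "f x = x" if f: "bij_betw f ?S ?S" and x: "x \<in> ?S"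
    and arcs: "\<And>x y. x \<in> ?S \<Longrightarrow> y \<in> ?S \<Longrightarrow> (\<exists>s\<in>?S. y = s \<otimes> x) \<longleftrightarrow> (\<exists>s\<in>?S. f y = s \<otimes> f x)"
    for f x
    by (rule rigid_on_four[OF f distinct arcs[folded R_def] R nR1 nR2 nR3 nR4 nR5 x])
qed auto

end

section \<open>Recognizing the exceptional groups\<close>

text \<open>The map runs from the concrete model \<open>M\<close> to \<open>G\<close>, so the
  homomorphism law and the kernel are checked on explicit elements of \<open>M\<close>. Surjectivity
  comes for free, the image being a subgroup that contains generators.\<close>

lemma (in group) iso_if_generated_kernel_trivial:
  assumes M: "group M" and h: "h \<in> hom M G" and T: "T \<subseteq> h ` carrier M" "generate G T = carrier G"
    and ker: "\<And>x. x \<in> carrier M \<Longrightarrow> h x = \<one> \<Longrightarrow> x = \<one>\<^bsub>M\<^esub>"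
  shows "G \<cong> M"
proof -
  interpret h: group_hom M G h using M h by (simp add: group_hom_def group_hom_axioms_def group_axioms)
  have "carrier G \<subseteq> h ` carrier M"
    using generate_subgroup_incl[OF T(1) h.img_is_subgroup] T(2) by simp
  then have "h ` carrier M = carrier G" by auto
  moreover have "inj_on h (carrier M)"
    using ker by (auto intro!: h.inj_on_one_iff[THEN iffD2])
  ultimately have "h \<in> iso M G" using h by (simp add: iso_def bij_betw_def)
  then show ?thesis using group.iso_sym[OF M] by (simp add: is_iso_def) blast
qed

lemma (in group) int_pow_commutes:
  assumes "x \<in> carrier G" "y \<in> carrier G" "x \<otimes> y = y \<otimes> x"
  shows "x [^] (i :: int) \<otimes> y = y \<otimes> x [^] i"
proof -
  have pow: "x [^] n \<otimes> y = y \<otimes> x [^] n" for n :: nat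
    using group_commutes_pow assms by simp
  have "inv p \<otimes> y = y \<otimes> inv p" if "p \<in> carrier G" "p \<otimes> y = y \<otimes> p" for p
    using that assms by (metis inv_closed inv_solve_left inv_solve_right m_assoc m_closed)
  moreover obtain n where "i = int n \<or> i = - int n" by (metis int_cases2)
  ultimately show ?thesis using pow[of n] assms(1) by (auto simp only: int_pow_int int_pow_neg_int nat_pow_closed)
qed

context noncyclic_pair
begin

text \<open>The isomorphism sends \<open>(i, j)\<close> to \<open>a [^] i \<otimes> b [^] j\<close>;
  with exponents restricted to the ranges of the two carriers, \<open>indep\<close> is triviality of
  its kernel.\<close>

lemma iso_product_of_cyclic:
  assumes comm: "b \<otimes> a = a \<otimes> b" and "0 < m" "0 < n"
    and am: "a [^] int m = \<one>" and bn: "b [^] int n = \<one>"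
    and indep: "\<And>i j. 0 \<le> i \<Longrightarrow> i < int m \<Longrightarrow> 0 \<le> j \<Longrightarrow> j < int n \<Longrightarrow> a [^] i \<otimes> b [^] j = \<one> \<Longrightarrow> i = 0 \<and> j = 0"
  shows "G \<cong> integer_mod_group m \<times>\<times> integer_mod_group n"
proof (rule iso_if_generated_kernel_trivial[OF _ _ _ gen])
  let ?M = "integer_mod_group m \<times>\<times> integer_mod_group n"
  let ?h = "\<lambda>(i :: int, j :: int). a [^] i \<otimes> b [^] j"
  have pmod: "x [^] (i mod int k) = x [^] i" if "x \<in> carrier G" "x [^] int k = \<one>" for x i and k :: nat
  proof -
    have "x [^] i = x [^] (int k * (i div int k) + i mod int k)" by simp
    also have "\<dots> = (x [^] int k) [^] (i div int k) \<otimes> x [^] (i mod int k)"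
      using that(1) by (simp only: int_pow_mult int_pow_pow)
    finally show ?thesis using that by simp
  qed
  have swap: "b [^] j \<otimes> a [^] i = a [^] i \<otimes> b [^] j" for i j :: int
    using comm by (intro int_pow_commutes int_pow_commutes[symmetric]) auto
  show "group ?M" by (simp add: DirProd_group)
  show "?h \<in> hom ?M G"
  proof (rule homI)
    fix x y assume "x \<in> carrier ?M" "y \<in> carrier ?M"
    obtain i j k l where xy: "x = (i, j)" "y = (k, l)" by (metis surj_pair)
    have "a [^] i \<otimes> a [^] k \<otimes> (b [^] j \<otimes> b [^] l) = a [^] i \<otimes> (a [^] k \<otimes> b [^] j) \<otimes> b [^] l"
      by (simp add: m_assoc)
    also have "\<dots> = a [^] i \<otimes> (b [^] j \<otimes> a [^] k) \<otimes> b [^] l"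
      by (simp only: swap)
    also have "\<dots> = a [^] i \<otimes> b [^] j \<otimes> (a [^] k \<otimes> b [^] l)"
      by (simp add: m_assoc)
    finally show "?h (x \<otimes>\<^bsub>?M\<^esub> y) = ?h x \<otimes> ?h y"
      using am bn by (simp add: xy pmod int_pow_mult)
  qed auto
  \<comment> \<open>The residue \<open>1 mod int m\<close> lies in the carrier also for
    \<open>m = 1\<close>, where \<open>1\<close> does not.\<close>
  have "a = ?h (1 mod int m, 0)" "b = ?h (0, 1 mod int n)" using am bn by (simp_all add: pmod)
  moreover have "(1 mod int m, 0) \<in> carrier ?M" "(0, 1 mod int n) \<in> carrier ?M"
    using assms(2,3) by (auto simp: carrier_integer_mod_group)
  ultimately show "{a, b} \<subseteq> ?h ` carrier ?M" by blast
  show "x = \<one>\<^bsub>?M\<^esub>" if "x \<in> carrier ?M" "?h x = \<one>" for x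
    using that indep[of "fst x" "snd x"] assms(2,3) by (cases x) (simp add: carrier_integer_mod_group)
qed

text \<open>The relations make the common square \<open>z\<close> of \<open>a\<close> and
  \<open>b\<close> central with \<open>z \<otimes> z = \<one>\<close> and give
  \<open>b \<otimes> a = z \<otimes> (a \<otimes> b)\<close>. So -1, i, j, k can be sent to
  \<open>z\<close>, \<open>a\<close>, \<open>b\<close>, \<open>a \<otimes> b\<close>.\<close>

lemma iso_quaternion_group:
  assumes aba: "a \<otimes> b \<otimes> a = b" and bab: "b \<otimes> a \<otimes> b = a" and "a \<otimes> a \<noteq> \<one>"
  shows "G \<cong> quaternion_group"
proof (rule iso_if_generated_kernel_trivial[OF group_quaternion_group _ _ gen])
  note pw = powers_mult_mem_iff mem_powers not_mem_powers
  define z where "z = a \<otimes> a"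
  have z [simp]: "z \<in> carrier G" by (simp add: z_def)
  have aa: "a \<otimes> a = z" by (simp add: z_def)
  have bb: "b \<otimes> b = z"
  proof -
    have "b \<otimes> b = b \<otimes> (a \<otimes> b \<otimes> a)" by (simp only: aba)
    also have "\<dots> = b \<otimes> a \<otimes> b \<otimes> a" by (simp add: m_assoc)
    finally show ?thesis by (simp only: bab aa)
  qed
  have az: "a \<otimes> z = z \<otimes> a" by (simp add: z_def m_assoc)
  have bz: "b \<otimes> z = z \<otimes> b" by (simp add: m_assoc flip: bb)
  have zab: "z \<otimes> (a \<otimes> b) = b \<otimes> a"
  proof -
    have "b \<otimes> a = a \<otimes> b \<otimes> a \<otimes> a" by (simp add: aba)
    also have "\<dots> = a \<otimes> (b \<otimes> z)" by (simp add: m_assoc aa)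
    also have "\<dots> = a \<otimes> z \<otimes> b" by (simp add: bz m_assoc)
    finally show ?thesis by (simp add: az m_assoc)
  qed
  have zz: "z \<otimes> z = \<one>"
  proof -
    have "a \<otimes> (a \<otimes> b \<otimes> a) \<otimes> a = b" by (simp only: aba)
    then have "z \<otimes> b \<otimes> z = b" by (simp add: z_def m_assoc)
    then have "b \<otimes> (z \<otimes> z) = b" by (simp add: m_assoc flip: bz)
    then show ?thesis by simp
  qed
  have az': "a \<otimes> (z \<otimes> x) = z \<otimes> (a \<otimes> x)" and bz': "b \<otimes> (z \<otimes> x) = z \<otimes> (b \<otimes> x)"
    and zz': "z \<otimes> (z \<otimes> x) = x" and ba': "b \<otimes> (a \<otimes> x) = z \<otimes> (a \<otimes> (b \<otimes> x))"
    and aa': "a \<otimes> (a \<otimes> x) = z \<otimes> x" and bb': "b \<otimes> (b \<otimes> x) = z \<otimes> x"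
    if x: "x \<in> carrier G" for x
  proof -
    have *: "u \<otimes> (v \<otimes> x) = p \<otimes> x" if "u \<otimes> v = p" "u \<in> carrier G" "v \<in> carrier G" for u v p
      using that x by (simp flip: m_assoc)
    show "a \<otimes> (z \<otimes> x) = z \<otimes> (a \<otimes> x)" "b \<otimes> (z \<otimes> x) = z \<otimes> (b \<otimes> x)"
      "z \<otimes> (z \<otimes> x) = x" "b \<otimes> (a \<otimes> x) = z \<otimes> (a \<otimes> (b \<otimes> x))"
      "a \<otimes> (a \<otimes> x) = z \<otimes> x" "b \<otimes> (b \<otimes> x) = z \<otimes> x"
      using x *[OF az] *[OF bz] *[OF zz] *[OF zab[symmetric]] *[OF aa] *[OF bb]
      by (simp_all add: m_assoc)
  qed
  \<comment> \<open>These rules rewrite every word in \<open>a\<close>, \<open>b\<close>,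
    \<open>z\<close> to at most one \<open>z\<close>, then at most one \<open>a\<close>, then at
    most one \<open>b\<close>; the primed ones act inside right-nested products.\<close>
  note nf = m_assoc az bz zz zab[symmetric] aa bb az' bz' zz' ba' aa' bb'
  \<comment> \<open>The last branch is the value at \<open>(0, 0, 0, -1)\<close> and the default
    outside the carrier.\<close>
  define h :: "int \<times> int \<times> int \<times> int \<Rightarrow> 'a" where
    "h q = (if q = (1,0,0,0) then \<one> else if q = (-1,0,0,0) then z
       else if q = (0,1,0,0) then a else if q = (0,-1,0,0) then z \<otimes> a
       else if q = (0,0,1,0) then b else if q = (0,0,-1,0) then z \<otimes> b
       else if q = (0,0,0,1) then a \<otimes> b else z \<otimes> (a \<otimes> b))" for q
  have h: "h (1, 0, 0, 0) = \<one>" "h (-1, 0, 0, 0) = z" "h (0, 1, 0, 0) = a" "h (0, -1, 0, 0) = z \<otimes> a"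
    "h (0, 0, 1, 0) = b" "h (0, 0, -1, 0) = z \<otimes> b" "h (0, 0, 0, 1) = a \<otimes> b" "h (0, 0, 0, -1) = z \<otimes> (a \<otimes> b)"
    by (simp_all add: h_def)
  show "h \<in> hom quaternion_group G"
  proof (rule homI)
    show "h q \<in> carrier G" for q by (auto simp: h_def)
    show "h (p \<otimes>\<^bsub>quaternion_group\<^esub> q) = h p \<otimes> h q"
      if "p \<in> carrier quaternion_group" "q \<in> carrier quaternion_group" for p q
      using that unfolding quaternion_group_def partial_object.simps monoid.simps
      by (elim insertE emptyE) (simp_all add: h nf)
  qed
  show "{a, b} \<subseteq> h ` carrier quaternion_group"
    using h(3,5) by (simp add: quaternion_group_def)
  have "z \<noteq> \<one>" "a \<noteq> \<one>" using assms(3) by (auto simp: z_def)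
  moreover have "z \<otimes> a \<noteq> \<one>"
  proof
    assume "z \<otimes> a = \<one>"
    then have "z \<otimes> (z \<otimes> a) = z" by simp
    then have "a = z" by (simp add: zz')
    then have "a = \<one>" unfolding z_def by simp
    then show False using assms(3) by simp
  qed
  moreover have "b \<noteq> \<one>" "z \<otimes> b \<noteq> \<one>" "a \<otimes> b \<noteq> \<one>" "z \<otimes> (a \<otimes> b) \<noteq> \<one>"
    unfolding z_def by (rule neq_if_powers; simp add: pw)+
  ultimately show "q = \<one>\<^bsub>quaternion_group\<^esub>" if "q \<in> carrier quaternion_group" "h q = \<one>" for q
    using that unfolding quaternion_group_def partial_object.simps monoid.simps
    by (elim insertE emptyE) (simp_all add: h)
qed

end

text \<open>
  A model of the group of order 16 with \<open>a\<^sup>4 = b\<^sup>4 = (ab)\<^sup>2 = (ab\<^sup>-\<^sup>1)\<^sup>2 = 1\<close>: the squares \<open>a\<^sup>2\<close> and \<open>b\<^sup>2\<close> are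
  central and \<open>ba = aba\<^sup>2b\<^sup>2\<close>; the tuple \<open>(i, j, k, l)\<close> stands for \<open>a\<^sup>i b\<^sup>j (a\<^sup>2)\<^sup>k (b\<^sup>2)\<^sup>l\<close>, with
  inequality of truth values as addition modulo 2.
\<close>

definition bool_group_16 :: "(bool \<times> bool \<times> bool \<times> bool) monoid" where
  "bool_group_16 =
     \<lparr>carrier = UNIV,
      monoid.mult = (\<lambda>(i, j, k, l) (i', j', k', l').
        (i \<noteq> i', j \<noteq> j', (k \<noteq> k') \<noteq> ((i \<and> i') \<noteq> (j \<and> i')), (l \<noteq> l') \<noteq> ((j \<and> j') \<noteq> (j \<and> i')))),
      one = (False, False, False, False)\<rparr>"

lemma group_bool_group_16: "group bool_group_16"
proof (rule groupI)
  show "x \<otimes>\<^bsub>bool_group_16\<^esub> y \<otimes>\<^bsub>bool_group_16\<^esub> z = x \<otimes>\<^bsub>bool_group_16\<^esub> (y \<otimes>\<^bsub>bool_group_16\<^esub> z)" for x y z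
    by (cases x; cases y; cases z) (simp add: bool_group_16_def, argo)
  show "\<exists>y\<in>carrier bool_group_16. y \<otimes>\<^bsub>bool_group_16\<^esub> x = \<one>\<^bsub>bool_group_16\<^esub>" for x
  proof -
    obtain i j k l where x: "x = (i, j, k, l)" by (metis prod_cases4)
    \<comment> \<open>The witness is forced: the inverse has the same first two coordinates, and the
      multiplication law is then solved for the last two.\<close>
    show ?thesis
      by (rule bexI[of _ "(i, j, k \<noteq> (i \<noteq> (j \<and> i)), l \<noteq> (j \<noteq> (j \<and> i)))"])
        (auto simp: bool_group_16_def x)
  qed
qed (auto simp: bool_group_16_def)

text \<open>Stated outside \<open>noncyclic_pair\<close> because it serves both \<open>G\<close> and
  the presented group. The relations make \<open>z = a \<otimes> a\<close> and
  \<open>w = b \<otimes> b\<close> central, which leaves at most 16 words in normal form; the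
  inequalities \<open>ne\<close> keep them distinct.\<close>

lemma (in group) iso_bool_group_16:
  assumes a [simp]: "a \<in> carrier G" and b [simp]: "b \<in> carrier G" and gen: "generate G {a, b} = carrier G"
    and a4: "a \<otimes> a \<otimes> (a \<otimes> a) = \<one>" and b4: "b \<otimes> b \<otimes> (b \<otimes> b) = \<one>"
    and abab: "a \<otimes> b \<otimes> (a \<otimes> b) = \<one>" and aBaB: "a \<otimes> inv b \<otimes> (a \<otimes> inv b) = \<one>"
    and ne: "a \<otimes> a \<noteq> \<one>" "b \<otimes> b \<noteq> \<one>" "a \<otimes> a \<noteq> b \<otimes> b"
  shows "G \<cong> bool_group_16"
proof (rule iso_if_generated_kernel_trivial[OF group_bool_group_16 _ _ gen])
  define z where "z = a \<otimes> a"
  define w where "w = b \<otimes> b"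
  have zw [simp]: "z \<in> carrier G" "w \<in> carrier G" by (simp_all add: z_def w_def)
  have aa: "a \<otimes> a = z" and bb: "b \<otimes> b = w" by (simp_all add: z_def w_def)
  have zz: "z \<otimes> z = \<one>" and ww: "w \<otimes> w = \<one>" using a4 b4 by (simp_all add: z_def w_def)
  have az: "a \<otimes> z = z \<otimes> a" and bw: "b \<otimes> w = w \<otimes> b" by (simp_all add: z_def w_def m_assoc)
  have aba: "a \<otimes> b \<otimes> a = inv b" and aBa: "a \<otimes> inv b \<otimes> a = b"
    using inv_equality[of "a \<otimes> b \<otimes> a" b] inv_equality[of "a \<otimes> inv b \<otimes> a" "inv b"] abab aBaB
    by (simp_all add: m_assoc)
  have Bb: "inv b \<otimes> (b \<otimes> x) = x" "b \<otimes> (inv b \<otimes> x) = x" if "x \<in> carrier G" for x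
    using that by (simp_all flip: m_assoc)
  have bz: "b \<otimes> z = z \<otimes> b"
  proof -
    \<comment> \<open>Multiplication by \<open>a\<close> on both sides exchanges \<open>b\<close>
      and \<open>inv b\<close>, so doing it twice fixes \<open>inv b\<close>.\<close>
    have "z \<otimes> inv b \<otimes> z = a \<otimes> (a \<otimes> inv b \<otimes> a) \<otimes> a" by (simp add: z_def m_assoc)
    then have "z \<otimes> (z \<otimes> inv b \<otimes> z) = z \<otimes> inv b" by (simp only: aBa aba)
    then have "(z \<otimes> z) \<otimes> (inv b \<otimes> z) = z \<otimes> inv b" by (simp add: m_assoc)
    then have "inv b \<otimes> z = z \<otimes> inv b" by (simp add: zz)
    then have "b \<otimes> (inv b \<otimes> z) \<otimes> b = b \<otimes> (z \<otimes> inv b) \<otimes> b" by simp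
    then show ?thesis by (simp add: m_assoc Bb)
  qed
  have aw: "a \<otimes> w = w \<otimes> a"
  proof -
    \<comment> \<open>Both relators equal \<open>\<one>\<close>, so \<open>a\<close> cancels from
      them; multiplying the rest by \<open>b\<close> on both sides gives
      \<open>w \<otimes> a \<otimes> w = a\<close>.\<close>
    have "a \<otimes> (b \<otimes> a \<otimes> b) = a \<otimes> (inv b \<otimes> a \<otimes> inv b)" using abab aBaB by (simp add: m_assoc)
    then have "b \<otimes> a \<otimes> b = inv b \<otimes> a \<otimes> inv b" by simp
    then have "b \<otimes> (b \<otimes> a \<otimes> b) \<otimes> b = b \<otimes> (inv b \<otimes> a \<otimes> inv b) \<otimes> b" by simp
    then have "w \<otimes> a \<otimes> w = a" by (simp add: w_def m_assoc Bb)
    then have "w \<otimes> a \<otimes> (w \<otimes> w) = a \<otimes> w" by (simp flip: m_assoc)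
    then show ?thesis by (simp add: ww)
  qed
  have wz: "w \<otimes> z = z \<otimes> w" 
  proof -
    have "w \<otimes> z = b \<otimes> (b \<otimes> z)" by (simp add: w_def m_assoc)
    also have "\<dots> = b \<otimes> z \<otimes> b" unfolding bz by (simp add: bz flip: m_assoc)
    also have "\<dots> = z \<otimes> w" unfolding bz by (simp add: w_def m_assoc)
    finally show ?thesis .
  qed
  have ba: "b \<otimes> a = z \<otimes> (w \<otimes> (a \<otimes> b))"
  proof -
    \<comment> \<open>In effect \<open>b \<otimes> a = inv a \<otimes> inv b\<close> with
      \<open>inv a = z \<otimes> a\<close> and \<open>inv b = w \<otimes> b\<close>; the computation
      inserts the relator \<open>abab\<close> in the middle.\<close>
    have "z \<otimes> (w \<otimes> (a \<otimes> b)) = z \<otimes> (w \<otimes> a) \<otimes> b" by (simp add: m_assoc)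
    also have "\<dots> = z \<otimes> a \<otimes> (a \<otimes> b \<otimes> (a \<otimes> b)) \<otimes> (w \<otimes> b)"
      unfolding abab aw[symmetric] by (simp add: m_assoc)
    also have "\<dots> = z \<otimes> (a \<otimes> a) \<otimes> (b \<otimes> a) \<otimes> (b \<otimes> w \<otimes> b)" by (simp add: m_assoc)
    also have "\<dots> = (z \<otimes> z) \<otimes> (b \<otimes> a) \<otimes> (w \<otimes> w)" by (simp add: aa bb bw m_assoc)
    finally show ?thesis by (simp add: zz ww)
  qed
  have nf': "a \<otimes> (z \<otimes> x) = z \<otimes> (a \<otimes> x)" "b \<otimes> (z \<otimes> x) = z \<otimes> (b \<otimes> x)"
    "a \<otimes> (w \<otimes> x) = w \<otimes> (a \<otimes> x)" "b \<otimes> (w \<otimes> x) = w \<otimes> (b \<otimes> x)"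
    "w \<otimes> (z \<otimes> x) = z \<otimes> (w \<otimes> x)" "b \<otimes> (a \<otimes> x) = z \<otimes> (w \<otimes> (a \<otimes> (b \<otimes> x)))"
    "z \<otimes> (z \<otimes> x) = x" "w \<otimes> (w \<otimes> x) = x" "a \<otimes> (a \<otimes> x) = z \<otimes> x" "b \<otimes> (b \<otimes> x) = w \<otimes> x"
    if x: "x \<in> carrier G" for x
  proof -
    have *: "u \<otimes> (v \<otimes> x) = p \<otimes> x" if "u \<otimes> v = p" "u \<in> carrier G" "v \<in> carrier G" for u v p
      using that x by (simp flip: m_assoc)
    show "a \<otimes> (z \<otimes> x) = z \<otimes> (a \<otimes> x)" "b \<otimes> (z \<otimes> x) = z \<otimes> (b \<otimes> x)"
    "a \<otimes> (w \<otimes> x) = w \<otimes> (a \<otimes> x)" "b \<otimes> (w \<otimes> x) = w \<otimes> (b \<otimes> x)"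
    "w \<otimes> (z \<otimes> x) = z \<otimes> (w \<otimes> x)" "b \<otimes> (a \<otimes> x) = z \<otimes> (w \<otimes> (a \<otimes> (b \<otimes> x)))"
    "z \<otimes> (z \<otimes> x) = x" "w \<otimes> (w \<otimes> x) = x" "a \<otimes> (a \<otimes> x) = z \<otimes> x" "b \<otimes> (b \<otimes> x) = w \<otimes> x"
      using x *[OF az] *[OF bz] *[OF aw] *[OF bw] *[OF wz] *[OF ba] *[OF zz] *[OF ww] *[OF aa] *[OF bb]
      by (simp_all add: m_assoc)
  qed
  note nf = m_assoc az bz aw bw wz zz ww aa bb ba nf'
  \<comment> \<open>\<open>p c x\<close> is the power of \<open>x\<close> whose exponent is the
    truth value \<open>c\<close>; in \<open>h\<close> the factors stand in the order of the normal
    form produced by \<open>nf\<close>.\<close>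
  define p where "p c x = (if c then x else \<one>)" for c x
  define h where "h = (\<lambda>(i, j, k, l). p k z \<otimes> (p l w \<otimes> (p i a \<otimes> p j b)))"
  show "h \<in> hom bool_group_16 G"
  proof (rule homI)
    show "h x \<in> carrier G" for x by (simp add: h_def p_def split: prod.split)
    show "h (x \<otimes>\<^bsub>bool_group_16\<^esub> y) = h x \<otimes> h y" for x y
    proof -
      obtain i j k l where x: "x = (i, j, k, l)" by (metis prod_cases4)
      obtain i' j' k' l' where y: "y = (i', j', k', l')" by (metis prod_cases4)
      show ?thesis unfolding x y
        by (cases i; cases j; cases k; cases l; cases i'; cases j'; cases k'; cases l')
          (simp_all add: bool_group_16_def h_def p_def nf)
    qed
  qed
  have "h (True, False, False, False) = a" "h (False, True, False, False) = b"
    by (simp_all add: h_def p_def)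
  then show "{a, b} \<subseteq> h ` carrier bool_group_16"
    by (auto simp: bool_group_16_def)
  \<comment> \<open>Otherwise \<open>x = n\<close>, so \<open>x\<close> squares to
    \<open>\<one>\<close> and commutes with \<open>a\<close>. But \<open>a\<close> and
    \<open>b\<close> have nontrivial squares, and \<open>a \<otimes> b\<close> commutes with
    \<open>a\<close> only if \<open>z = w\<close>.\<close>
  have N: "n \<otimes> x \<noteq> \<one>" if "n \<in> {\<one>, z, w, z \<otimes> w}" "x \<in> {a, b, a \<otimes> b}" for n x
  proof
    assume nx: "n \<otimes> x = \<one>"
    have nc: "n \<in> carrier G" "x \<in> carrier G" using that by auto
    have nn: "n \<otimes> n = \<one>" and an: "a \<otimes> n = n \<otimes> a" using that(1) by (auto simp: nf)
    have "x = n \<otimes> n \<otimes> x" using nn nc by simp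
    then have "x = n" using nx nc by (simp add: m_assoc)
    then have "x \<otimes> x = \<one>" "a \<otimes> x = x \<otimes> a" using nn an by simp_all
    then show False using that(2) ne aa bb by (auto simp: nf)
  qed
  have "z \<noteq> \<one>" "w \<noteq> \<one>" "z \<otimes> w \<noteq> \<one>"
    using ne aa bb zz zw by (auto, metis l_cancel)
  note ne' = this N[of \<one> a] N[of \<one> b] N[of \<one> "a \<otimes> b"] N[of z a] N[of z b] N[of z "a \<otimes> b"]
    N[of w a] N[of w b] N[of w "a \<otimes> b"]
    N[of "z \<otimes> w" a] N[of "z \<otimes> w" b] N[of "z \<otimes> w" "a \<otimes> b"]
  show "x = \<one>\<^bsub>bool_group_16\<^esub>" if "h x = \<one>" for x
  proof -
    obtain i j k l where x: "x = (i, j, k, l)" by (metis prod_cases4)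
    show ?thesis using that ne' unfolding x
      by (cases i; cases j; cases k; cases l) (simp_all add: h_def p_def bool_group_16_def m_assoc)
  qed
qed

section \<open>Groups without an ORR\<close>

text \<open>A group automorphism that preserves \<open>S\<close> preserves arcs and fixes
  \<open>\<one>\<close>, whereas the only right translation fixing \<open>\<one>\<close> is the
  identity.\<close>

lemma (in group) automorphisms_neq_if_group_automorphism:
  assumes \<phi>: "\<phi> \<in> iso G G" and S: "\<And>x. x \<in> carrier G \<Longrightarrow> \<phi> x \<in> S \<longleftrightarrow> x \<in> S"
    and x: "x \<in> carrier G" "\<phi> x \<noteq> x"
  shows "digraph_automorphisms (cayley_digraph G S) \<noteq> right_regular_rep G"
proof
  assume eq: "digraph_automorphisms (cayley_digraph G S) = right_regular_rep G"
  interpret \<phi>: group_hom G G \<phi>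
    using \<phi> by (simp add: group_hom_def group_hom_axioms_def iso_def)
  have bij: "bij_betw \<phi> (carrier G) (carrier G)" using \<phi> by (simp add: iso_def)
  let ?f = "restrict \<phi> (carrier G)"
  have "?f \<in> digraph_automorphisms (cayley_digraph G S)"
  proof -
    have "?f \<in> Bij (carrier G)" using bij by (simp add: Bij_def)
    moreover have "y \<otimes> inv x \<in> S \<longleftrightarrow> \<phi> y \<otimes> inv (\<phi> x) \<in> S" if "x \<in> carrier G" "y \<in> carrier G" for x y
      using S[of "y \<otimes> inv x"] that by simp
    ultimately show ?thesis by (simp add: digraph_automorphisms_def cayley_digraph_def)
  qed
  then obtain g where g: "g \<in> carrier G" "?f = (\<lambda>x\<in>carrier G. x \<otimes> g)"
    unfolding eq right_regular_rep_def by auto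
  have f: "\<phi> y = y \<otimes> g" if "y \<in> carrier G" for y
    using fun_cong[OF g(2), of y] that by simp
  from f[of \<one>] g have "g = \<one>" by simp
  then show False using f[of x] x by simp
qed

definition oriented_subsets_symmetric :: "('a, 'b) monoid_scheme \<Rightarrow> bool" where
  "oriented_subsets_symmetric H \<longleftrightarrow>
     (\<forall>S\<subseteq>carrier H. (\<forall>x\<in>S. inv\<^bsub>H\<^esub> x \<notin> S) \<longrightarrow>
        (\<exists>\<phi>\<in>iso H H. (\<forall>x\<in>carrier H. \<phi> x \<in> S \<longleftrightarrow> x \<in> S) \<and> (\<exists>x\<in>carrier H. \<phi> x \<noteq> x)))"

text \<open>The isomorphism carries an admissible \<open>S\<close> to an admissible subset of
  \<open>H\<close>; the automorphism that preserves the latter is conjugated back to one of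
  \<open>G\<close> that preserves \<open>S\<close>.\<close>

lemma (in group) not_admits_ORR_if_iso:
  assumes H: "group H" "G \<cong> H" and sym: "oriented_subsets_symmetric H"
  shows "\<not> admits_ORR G"
proof
  assume "admits_ORR G"
  then obtain S where S: "S \<subseteq> carrier G" "S \<inter> m_inv G ` S = {}"
    and eq: "digraph_automorphisms (cayley_digraph G S) = right_regular_rep G"
    by (auto simp: admits_ORR_def)
  obtain f where f: "f \<in> iso G H" using H by (auto simp: is_iso_def)
  let ?g = "inv_into (carrier G) f"
  have g: "?g \<in> iso H G" by (rule iso_set_sym[OF f])
  have bij: "bij_betw f (carrier G) (carrier H)" using f by (simp add: iso_def)
  interpret f: group_hom G H f
    using f H by (simp add: group_hom_def group_hom_axioms_def iso_def group_axioms)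
  have fg: "f (?g y) = y" if "y \<in> carrier H" for y
    using bij that by (simp add: bij_betw_inv_into_right)
  have gf: "?g (f x) = x" if "x \<in> carrier G" for x
    using bij that by (simp add: bij_betw_inv_into_left)
  have memf: "f x \<in> f ` S \<longleftrightarrow> x \<in> S" if "x \<in> carrier G" for x
    using inj_on_image_mem_iff[OF bij_betw_imp_inj_on[OF bij]] S(1) that by blast
  have "f ` S \<subseteq> carrier H" using S bij by (auto simp: bij_betw_def)
  moreover have "inv\<^bsub>H\<^esub> y \<notin> f ` S" if y: "y \<in> f ` S" for y
  proof -
    obtain x where x: "x \<in> S" "y = f x" using y by blast
    then have "inv x \<notin> S" using S by auto
    then show ?thesis using memf[of "inv x"] x S by (auto simp: subset_iff)
  qed
  ultimately have "\<exists>\<phi>\<in>iso H H. (\<forall>y\<in>carrier H. \<phi> y \<in> f ` S \<longleftrightarrow> y \<in> f ` S) \<and> (\<exists>y\<in>carrier H. \<phi> y \<noteq> y)"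
    using sym unfolding oriented_subsets_symmetric_def by simp
  then obtain \<phi> y where \<phi>: "\<phi> \<in> iso H H" "\<And>y. y \<in> carrier H \<Longrightarrow> \<phi> y \<in> f ` S \<longleftrightarrow> y \<in> f ` S"
    and y: "y \<in> carrier H" "\<phi> y \<noteq> y"
    by auto
  have \<phi>cl: "\<phi> y \<in> carrier H" if "y \<in> carrier H" for y
    using \<phi>(1) that by (auto simp: iso_def hom_def)
  let ?\<psi> = "?g \<circ> (\<phi> \<circ> f)"
  have gcl: "?g y \<in> carrier G" if "y \<in> carrier H" for y
    using g that by (auto simp: iso_def hom_def)
  have "?\<psi> \<in> iso G G" by (rule iso_set_trans[OF iso_set_trans[OF f \<phi>(1)] g])
  moreover have "?\<psi> x \<in> S \<longleftrightarrow> x \<in> S" if "x \<in> carrier G" for x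
    using that memf[of "?\<psi> x"] memf[of x] \<phi>(2)[of "f x"] by (simp add: gcl \<phi>cl fg)
  moreover have "?\<psi> (?g y) \<noteq> ?g y" using y fg gcl \<phi>cl by (metis comp_apply)
  ultimately show False
    using automorphisms_neq_if_group_automorphism[OF _ _ gcl[OF y(1)], of ?\<psi> S] eq by blast
qed

lemma isoI_if_endo_kernel_trivial:
  assumes H: "group H" "finite (carrier H)" and h: "\<phi> \<in> hom H H"
    and ker: "\<And>x. x \<in> carrier H \<Longrightarrow> \<phi> x = \<one>\<^bsub>H\<^esub> \<Longrightarrow> x = \<one>\<^bsub>H\<^esub>"
  shows "\<phi> \<in> iso H H"
proof -
  interpret h: group_hom H H \<phi> using H h by (simp add: group_hom_def group_hom_axioms_def)
  have "inj_on \<phi> (carrier H)" using ker by (auto intro!: h.inj_on_one_iff[THEN iffD2])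
  moreover have "\<phi> ` carrier H = carrier H"
    using calculation H by (intro endo_inj_surj) auto
  ultimately show ?thesis using h by (simp add: iso_def bij_betw_def)
qed

text \<open>In this contrapositive form each explicit nontrivial automorphism contributes one
  propositional constraint on membership in \<open>S\<close>. For a concrete small group, finitely
  many of these contradict the orientation conditions.\<close>

lemma oriented_subsets_symmetricI:
  assumes H: "group H" "finite (carrier H)"
    and contr: "\<And>S. \<forall>x\<in>S. inv\<^bsub>H\<^esub> x \<notin> S \<Longrightarrow>
      (\<And>f. f \<in> hom H H \<Longrightarrow> (\<And>x. x \<in> carrier H \<Longrightarrow> f x = \<one>\<^bsub>H\<^esub> \<Longrightarrow> x = \<one>\<^bsub>H\<^esub>) \<Longrightarrow>
        \<exists>x\<in>carrier H. f x \<noteq> x \<Longrightarrow> \<exists>x\<in>carrier H. f x \<in> S \<longleftrightarrow> x \<notin> S) \<Longrightarrow> False"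
  shows "oriented_subsets_symmetric H"
  unfolding oriented_subsets_symmetric_def
proof (intro allI impI, rule ccontr)
  fix S
  assume oriented: "\<forall>x\<in>S. inv\<^bsub>H\<^esub> x \<notin> S"
    and no: "\<not> (\<exists>\<phi>\<in>iso H H. (\<forall>x\<in>carrier H. \<phi> x \<in> S \<longleftrightarrow> x \<in> S) \<and> (\<exists>x\<in>carrier H. \<phi> x \<noteq> x))"
  show False
  proof (rule contr)
    fix f assume "f \<in> hom H H" "\<And>x. x \<in> carrier H \<Longrightarrow> f x = \<one>\<^bsub>H\<^esub> \<Longrightarrow> x = \<one>\<^bsub>H\<^esub>" and moved: "\<exists>x\<in>carrier H. f x \<noteq> x"
    then have "f \<in> iso H H" by (intro isoI_if_endo_kernel_trivial H)
    then have "\<not> (\<forall>x\<in>carrier H. f x \<in> S \<longleftrightarrow> x \<in> S)" using no moved by auto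
    then show "\<exists>x\<in>carrier H. f x \<in> S \<longleftrightarrow> x \<notin> S" by auto
  qed (rule oriented)
qed

section \<open>Explicit automorphisms of the four exceptional groups\<close>

lemma mod_linear:
  fixes c u v n :: int
  shows "(c * (u mod n) + v) mod n = (c * u + v) mod n" "(v + c * (u mod n)) mod n = (v + c * u) mod n"
proof -
  have "(c * (u mod n) + v) mod n = (c * (u mod n) mod n + v) mod n" by (simp only: mod_add_left_eq)
  also have "\<dots> = (c * u + v) mod n" by (simp only: mod_mult_right_eq mod_add_left_eq)
  finally show "(c * (u mod n) + v) mod n = (c * u + v) mod n" .
  then show "(v + c * (u mod n)) mod n = (v + c * u) mod n" by (simp only: add.commute)
qed

text \<open>The homomorphism law for one row \<open>(p, q)\<close> of an integer matrix acting on
  residues.\<close>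

lemma mod_linear_add:
  fixes p q x x' y y' n :: int
  shows "(p * ((x + x') mod n) + q * ((y + y') mod n)) mod n =
    ((p * x + q * y) mod n + (p * x' + q * y') mod n) mod n"
  by (simp only: mod_linear mod_add_eq) (simp add: algebra_simps)

text \<open>
  In the next three lemmas and in the corresponding one for the group of order 16, the listed
  automorphisms were chosen such that every subset containing at most one element of each inverse
  pair is invariant under one of them.
\<close>

lemma oriented_subsets_symmetric_C3_times_C3:
  "oriented_subsets_symmetric (integer_mod_group 3 \<times>\<times> integer_mod_group 3)" (is "oriented_subsets_symmetric ?H")
proof (rule oriented_subsets_symmetricI)
  have three: "{0..<3} = {0, 1, 2 :: int}" by auto
  have carr: "carrier ?H = {0, 1, 2} \<times> {0, 1, 2}"
    by (simp add: carrier_integer_mod_group three)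
  show "group ?H" by (simp add: DirProd_group)
  show "finite (carrier ?H)" unfolding carr by simp
  fix S assume oriented: "\<forall>x\<in>S. inv\<^bsub>?H\<^esub> x \<notin> S"
    and sym: "\<And>f. f \<in> hom ?H ?H \<Longrightarrow> (\<And>x. x \<in> carrier ?H \<Longrightarrow> f x = \<one>\<^bsub>?H\<^esub> \<Longrightarrow> x = \<one>\<^bsub>?H\<^esub>) \<Longrightarrow>
        \<exists>x\<in>carrier ?H. f x \<noteq> x \<Longrightarrow> \<exists>x\<in>carrier ?H. f x \<in> S \<longleftrightarrow> x \<notin> S"
  \<comment> \<open>The automorphism has the matrix with rows \<open>(p, q)\<close> and
    \<open>(r, s)\<close>; \<open>ker\<close> says that it is invertible modulo 3 and
    \<open>moved\<close> that it is not the identity.\<close>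
  have matrix: "\<exists>x\<in>{0, 1, 2}. \<exists>y\<in>{0, 1, 2}. ((p * x + q * y) mod 3, (r * x + s * y) mod 3) \<in> S \<longleftrightarrow> (x, y) \<notin> S"
    if ker: "\<forall>x\<in>{0, 1, 2}. \<forall>y\<in>{0, 1, 2}. (p * x + q * y) mod 3 = 0 \<and> (r * x + s * y) mod 3 = 0 \<longrightarrow> x = 0 \<and> y = 0"
      and moved: "(p mod 3, r mod 3) \<noteq> (1, 0) \<or> (q mod 3, s mod 3) \<noteq> (0, 1)"
    for p q r s
  proof -
    let ?f = "\<lambda>(x, y). ((p * x + q * y) mod 3, (r * x + s * y) mod 3)"
    have hom: "?f \<in> hom ?H ?H"
      by (rule homI) (auto simp: carrier_integer_mod_group mod_linear_add)
    have "\<exists>v\<in>carrier ?H. ?f v \<in> S \<longleftrightarrow> v \<notin> S"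
    proof (rule sym[OF hom])
      fix v assume v: "v \<in> carrier ?H" "?f v = \<one>\<^bsub>?H\<^esub>"
      obtain x y where xy: "v = (x, y)" by (cases v)
      then have mem: "x \<in> {0, 1, 2}" "y \<in> {0, 1, 2}" using v(1) unfolding carr by blast+
      have "(p * x + q * y) mod 3 = 0 \<and> (r * x + s * y) mod 3 = 0" using v(2) by (simp add: xy)
      with bspec[OF bspec[OF ker mem(1)] mem(2)] have "x = 0 \<and> y = 0" by (rule mp)
      then show "v = \<one>\<^bsub>?H\<^esub>" by (simp add: xy)
    next
      have "?f (1, 0) \<noteq> (1, 0) \<or> ?f (0, 1) \<noteq> (0, 1)" using moved by auto
      then show "\<exists>v\<in>carrier ?H. ?f v \<noteq> v" unfolding carr by blast
    qed
    then show ?thesis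
      unfolding carr Bex_def mem_Times_iff split_paired_Ex by (simp only: Bex_def fst_conv snd_conv prod.case) blast
  qed
  have "(0, 1) \<notin> S \<or> (0, 2) \<notin> S" "(1, 0) \<notin> S \<or> (2, 0) \<notin> S" "(1, 1) \<notin> S \<or> (2, 2) \<notin> S"
    "(1, 2) \<notin> S \<or> (2, 1) \<notin> S" "(0, 0) \<notin> S"
    using oriented by (force simp: carrier_integer_mod_group)+
  note facts = this
      matrix[of 1 0 1 1, simplified] matrix[of 0 2 2 0, simplified] matrix[of 2 2 0 1, simplified]
      matrix[of 1 2 0 2, simplified] matrix[of 2 2 1 0, simplified] matrix[of 1 0 0 2, simplified]
      matrix[of 2 0 1 1, simplified] matrix[of 1 0 2 2, simplified] matrix[of 1 2 0 1, simplified]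
      matrix[of 0 2 1 2, simplified] matrix[of 0 1 1 0, simplified] matrix[of 2 1 0 1, simplified]
      matrix[of 2 0 2 1, simplified] matrix[of 1 1 0 2, simplified] matrix[of 2 0 0 1, simplified]
      matrix[of 1 0 1 2, simplified]
  from facts show False by (smt (verit))
qed

lemma oriented_subsets_symmetric_C4_times_C2:
  "oriented_subsets_symmetric (integer_mod_group 4 \<times>\<times> integer_mod_group 2)" (is "oriented_subsets_symmetric ?H")
proof (rule oriented_subsets_symmetricI)
  have "{0..<4} = {0, 1, 2, 3 :: int}" "{0..<2} = {0, 1 :: int}" by auto
  then have carr: "carrier ?H = {0, 1, 2, 3} \<times> {0, 1}"
    by (simp add: carrier_integer_mod_group)
  show "group ?H" by (simp add: DirProd_group)
  show "finite (carrier ?H)" unfolding carr by simp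
  fix S assume oriented: "\<forall>x\<in>S. inv\<^bsub>?H\<^esub> x \<notin> S"
    and sym: "\<And>f. f \<in> hom ?H ?H \<Longrightarrow> (\<And>x. x \<in> carrier ?H \<Longrightarrow> f x = \<one>\<^bsub>?H\<^esub> \<Longrightarrow> x = \<one>\<^bsub>?H\<^esub>) \<Longrightarrow>
        \<exists>x\<in>carrier ?H. f x \<noteq> x \<Longrightarrow> \<exists>x\<in>carrier ?H. f x \<in> S \<longleftrightarrow> x \<notin> S"
  \<comment> \<open>An automorphism fixes \<open>(2, 0)\<close>, the only nontrivial square, so it
    sends \<open>(0, 1)\<close> to another involution. Hence the factor 2 in the first coordinate
    and the coefficient 1 of \<open>y\<close> in the second.\<close>
  have matrix: "\<exists>x\<in>{0, 1, 2, 3}. \<exists>y\<in>{0, 1}. ((p * x + q * (2 * y)) mod 4, (r * x + y) mod 2) \<in> S \<longleftrightarrow> (x, y) \<notin> S"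
    if ker: "\<forall>x\<in>{0, 1, 2, 3}. \<forall>y\<in>{0, 1}. (p * x + q * (2 * y)) mod 4 = 0 \<and> (r * x + y) mod 2 = 0 \<longrightarrow> x = 0 \<and> y = 0"
      and moved: "(p mod 4, r mod 2) \<noteq> (1, 0) \<or> (q * 2) mod 4 \<noteq> 0"
    for p q r
  proof -
    let ?f = "\<lambda>(x, y). ((p * x + q * (2 * y)) mod 4, (r * x + y) mod 2)"
    have "(p * ((x + x') mod 4) + q * (2 * ((y + y') mod 2))) mod 4 =
        ((p * x + q * (2 * y)) mod 4 + (p * x' + q * (2 * y')) mod 4) mod 4"
      "(r * ((x + x') mod 4) + (y + y') mod 2) mod 2 = ((r * x + y) mod 2 + (r * x' + y') mod 2) mod 2"
      for x x' y y'
    proof -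
      \<comment> \<open>Doubling turns the reduction modulo 2 into one modulo 4, so that
        \<open>mod_linear_add\<close> applies with a single modulus.\<close>
      have "2 * ((y + y') mod 2) = (2 * y + 2 * y') mod 4"
        using mult_mod_right[of 2 "y + y'" 2] by simp
      then show "(p * ((x + x') mod 4) + q * (2 * ((y + y') mod 2))) mod 4 =
        ((p * x + q * (2 * y)) mod 4 + (p * x' + q * (2 * y')) mod 4) mod 4"
        by (simp only: mod_linear_add)
      have "(r * (u mod 4) + v) mod 2 = (r * u + v) mod 2" for u v :: int
        using mod_linear(1)[of r "u mod 4" 2 v] mod_linear(1)[of r u 2 v] by (simp add: mod_mod_cancel)
      then show "(r * ((x + x') mod 4) + (y + y') mod 2) mod 2 = ((r * x + y) mod 2 + (r * x' + y') mod 2) mod 2"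
        by (simp only: mod_add_left_eq mod_add_right_eq mod_add_eq) (simp add: algebra_simps)
    qed
    then have hom: "?f \<in> hom ?H ?H"
      by (intro homI) (auto simp: carrier_integer_mod_group)
    have "\<exists>v\<in>carrier ?H. ?f v \<in> S \<longleftrightarrow> v \<notin> S"
    proof (rule sym[OF hom])
      fix v assume v: "v \<in> carrier ?H" "?f v = \<one>\<^bsub>?H\<^esub>"
      obtain x y where xy: "v = (x, y)" by (cases v)
      then have mem: "x \<in> {0, 1, 2, 3}" "y \<in> {0, 1}" using v(1) unfolding carr by blast+
      have "(p * x + q * (2 * y)) mod 4 = 0 \<and> (r * x + y) mod 2 = 0" using v(2) by (simp add: xy)
      with bspec[OF bspec[OF ker mem(1)] mem(2)] have "x = 0 \<and> y = 0" by (rule mp)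
      then show "v = \<one>\<^bsub>?H\<^esub>" by (simp add: xy)
    next
      have "?f (1, 0) \<noteq> (1, 0) \<or> ?f (0, 1) \<noteq> (0, 1)" using moved by auto
      then show "\<exists>v\<in>carrier ?H. ?f v \<noteq> v" unfolding carr by blast
    qed
    then show ?thesis
      unfolding carr Bex_def mem_Times_iff split_paired_Ex by (simp only: Bex_def fst_conv snd_conv prod.case) blast
  qed
  have "(1, 0) \<notin> S \<or> (3, 0) \<notin> S" "(1, 1) \<notin> S \<or> (3, 1) \<notin> S"
    "(0, 0) \<notin> S" "(2, 0) \<notin> S" "(0, 1) \<notin> S" "(2, 1) \<notin> S"
    using oriented by (force simp: carrier_integer_mod_group)+
  then show False
    using matrix[of 1 0 1, simplified] matrix[of 1 1 0, simplified] matrix[of 3 1 0, simplified]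
      matrix[of 3 0 1, simplified]
    by (smt (verit))
qed

lemma oriented_subsets_symmetric_quaternion_group:
  "oriented_subsets_symmetric quaternion_group" (is "oriented_subsets_symmetric ?H")
proof (rule oriented_subsets_symmetricI)
  show "group ?H" by (rule group_quaternion_group)
  show "finite (carrier ?H)" by (simp add: quaternion_group_def)
  fix S assume oriented: "\<forall>x\<in>S. inv\<^bsub>?H\<^esub> x \<notin> S"
    and sym: "\<And>f. f \<in> hom ?H ?H \<Longrightarrow> (\<And>x. x \<in> carrier ?H \<Longrightarrow> f x = \<one>\<^bsub>?H\<^esub> \<Longrightarrow> x = \<one>\<^bsub>?H\<^esub>) \<Longrightarrow>
        \<exists>x\<in>carrier ?H. f x \<noteq> x \<Longrightarrow> \<exists>x\<in>carrier ?H. f x \<in> S \<longleftrightarrow> x \<notin> S"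
  interpret group ?H by (rule group_quaternion_group)
  have inv: "inv\<^bsub>?H\<^esub> x = y" if "x \<in> carrier ?H" "y \<in> carrier ?H" "hamilton_product y x = (1, 0, 0, 0)" for x y
    using that by (intro inv_equality) (simp_all add: quaternion_group_def)
  have excl: "(0, 1, 0, 0) \<notin> S \<or> (0, -1, 0, 0) \<notin> S" "(0, 0, 1, 0) \<notin> S \<or> (0, 0, -1, 0) \<notin> S"
    "(0, 0, 0, 1) \<notin> S \<or> (0, 0, 0, -1) \<notin> S" "(1, 0, 0, 0) \<notin> S" "(-1, 0, 0, 0) \<notin> S"
    using oriented inv[of "(0, 1, 0, 0)" "(0, -1, 0, 0)"] inv[of "(0, 0, 1, 0)" "(0, 0, -1, 0)"]
      inv[of "(0, 0, 0, 1)" "(0, 0, 0, -1)"] inv[of "(1, 0, 0, 0)" "(1, 0, 0, 0)"]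
      inv[of "(-1, 0, 0, 0)" "(-1, 0, 0, 0)"]
    by (auto simp: quaternion_group_def)
  \<comment> \<open>The maps are signed permutations of the imaginary coordinates with determinant
    1. Such rotations respect the quaternion product and permute the eight units.\<close>
  have "\<exists>x\<in>carrier ?H. f x \<in> S \<longleftrightarrow> x \<notin> S" if "f \<in> {\<lambda>(w, x, y, z). (w, -z, -x, y), \<lambda>(w, x, y, z). (w, -y, -z, x),
      \<lambda>(w, x, y, z). (w, y, z, x), \<lambda>(w, x, y, z). (w, -z, x, -y),
      \<lambda>(w, x, y, z). (w, z, y, -x), \<lambda>(w, x, y, z). (w, z, -y, x),
      \<lambda>(w, x, y, z). (w, -z, -y, -x), \<lambda>(w, x, y, z). (w, -x, -y, z),
      \<lambda>(w, x, y, z). (w, x, -z, y), \<lambda>(w, x, y, z). (w, -y, -x, -z),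
      \<lambda>(w, x, y, z). (w, y, x, -z), \<lambda>(w, x, y, z). (w, -x, -z, -y),
      \<lambda>(w, x, y, z). (w, -x, z, y)}" (is "f \<in> ?F") for f
  proof (rule sym)
    have hamilton: "f (hamilton_product (w, x, y, z) (w', x', y', z')) =
        hamilton_product (f (w, x, y, z)) (f (w', x', y', z'))" for w x y z w' x' y' z'
      using that by (elim insertE emptyE) (simp_all add: algebra_simps)
    have closed: "f x \<in> carrier ?H" if "x \<in> carrier ?H" for x
      using that \<open>f \<in> ?F\<close> unfolding quaternion_group_def partial_object.simps
      by (elim insertE emptyE) simp_all
    have "f (hamilton_product p q) = hamilton_product (f p) (f q)" for p q
      using hamilton by (metis prod_cases4)
    then show "f \<in> hom ?H ?H"
      using closed by (intro homI) (simp_all add: quaternion_group_def)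
    have "\<forall>x\<in>carrier ?H. f x = \<one>\<^bsub>?H\<^esub> \<longrightarrow> x = \<one>\<^bsub>?H\<^esub>"
      using that unfolding quaternion_group_def partial_object.simps monoid.simps
      by (elim insertE emptyE; simp)
    then show "x = \<one>\<^bsub>?H\<^esub>" if "x \<in> carrier ?H" "f x = \<one>\<^bsub>?H\<^esub>" for x using that by blast
    show "\<exists>x\<in>carrier ?H. f x \<noteq> x"
      using that unfolding quaternion_group_def partial_object.simps
      by (elim insertE emptyE; simp)
  qed
  then have "\<forall>f\<in>?F. \<exists>x\<in>carrier ?H. f x \<in> S \<longleftrightarrow> x \<notin> S" by blast
  then show False
    using excl by (simp add: quaternion_group_def) (smt (verit))
qed

lemma oriented_subsets_symmetric_bool_group_16:
  "oriented_subsets_symmetric bool_group_16" (is "oriented_subsets_symmetric ?H")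
proof (rule oriented_subsets_symmetricI)
  show "group ?H" by (rule group_bool_group_16)
  show "finite (carrier ?H)" by (simp add: bool_group_16_def)
  fix S assume oriented: "\<forall>x\<in>S. inv\<^bsub>?H\<^esub> x \<notin> S"
    and sym: "\<And>f. f \<in> hom ?H ?H \<Longrightarrow> (\<And>x. x \<in> carrier ?H \<Longrightarrow> f x = \<one>\<^bsub>?H\<^esub> \<Longrightarrow> x = \<one>\<^bsub>?H\<^esub>) \<Longrightarrow>
        \<exists>x\<in>carrier ?H. f x \<noteq> x \<Longrightarrow> \<exists>x\<in>carrier ?H. f x \<in> S \<longleftrightarrow> x \<notin> S"
  interpret group ?H by (rule group_bool_group_16)
  have inv: "(i, j, k, l) \<notin> S \<or> (i, j, k \<noteq> (i \<noteq> (j \<and> i)), l \<noteq> (j \<noteq> (j \<and> i))) \<notin> S" for i j k l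
  proof -
    have "inv\<^bsub>?H\<^esub> (i, j, k, l) = (i, j, k \<noteq> (i \<noteq> (j \<and> i)), l \<noteq> (j \<noteq> (j \<and> i)))"
      by (rule inv_equality) (auto simp: bool_group_16_def)
    then show ?thesis using oriented by (metis (no_types, lifting))
  qed
  \<comment> \<open>With \<open>z\<close> and \<open>w\<close> for the squares of \<open>a\<close>
    and \<open>b\<close>, this automorphism multiplies \<open>a\<close> by z^p w^q and
    \<open>b\<close> by z^r w^s, and it fixes \<open>z\<close> and \<open>w\<close>.\<close>
  have shift: "\<exists>i j k l. (i, j, k \<noteq> ((i \<and> p) \<noteq> (j \<and> r)), l \<noteq> ((i \<and> q) \<noteq> (j \<and> s))) \<in> S \<longleftrightarrow> (i, j, k, l) \<notin> S"
    if "p \<or> q \<or> r \<or> s" for p q r s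
  proof -
    let ?f = "\<lambda>(i, j, k, l). (i, j, k \<noteq> ((i \<and> p) \<noteq> (j \<and> r)), l \<noteq> ((i \<and> q) \<noteq> (j \<and> s)))"
    have "\<exists>x\<in>carrier ?H. ?f x \<in> S \<longleftrightarrow> x \<notin> S"
    proof (rule sym)
      have "?f ((i, j, k, l) \<otimes>\<^bsub>?H\<^esub> (i', j', k', l')) = ?f (i, j, k, l) \<otimes>\<^bsub>?H\<^esub> ?f (i', j', k', l')" for i j k l i' j' k' l'
        unfolding bool_group_16_def monoid.simps prod.case prod.inject by argo
      then show "?f \<in> hom ?H ?H" by (auto simp: hom_def bool_group_16_def)
      show "x = \<one>\<^bsub>?H\<^esub>" if "?f x = \<one>\<^bsub>?H\<^esub>" for x
        using that by (cases x) (auto simp: bool_group_16_def)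
      have "?f (True, False, False, False) \<noteq> (True, False, False, False) \<or>
          ?f (False, True, False, False) \<noteq> (False, True, False, False)" using that by auto
      then show "\<exists>x\<in>carrier ?H. ?f x \<noteq> x" unfolding bool_group_16_def partial_object.simps by blast
    qed
    then show ?thesis unfolding Bex_def split_paired_Ex prod.case by blast
  qed
  \<comment> \<open>Here \<open>a\<close> and \<open>b\<close> are exchanged first, and with them
    their squares; the terms \<open>i \<and> j\<close> restore the normal form of
    \<open>ba\<close>.\<close>
  have swap: "\<exists>i j k l. (j, i, (l \<noteq> (i \<and> j)) \<noteq> ((i \<and> p) \<noteq> (j \<and> r)), (k \<noteq> (i \<and> j)) \<noteq> ((i \<and> q) \<noteq> (j \<and> s))) \<in> S \<longleftrightarrow> (i, j, k, l) \<notin> S"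
    for p q r s
  proof -
    let ?f = "\<lambda>(i, j, k, l). (j, i, (l \<noteq> (i \<and> j)) \<noteq> ((i \<and> p) \<noteq> (j \<and> r)), (k \<noteq> (i \<and> j)) \<noteq> ((i \<and> q) \<noteq> (j \<and> s)))"
    have "\<exists>x\<in>carrier ?H. ?f x \<in> S \<longleftrightarrow> x \<notin> S"
    proof (rule sym)
      have "?f ((i, j, k, l) \<otimes>\<^bsub>?H\<^esub> (i', j', k', l')) = ?f (i, j, k, l) \<otimes>\<^bsub>?H\<^esub> ?f (i', j', k', l')" for i j k l i' j' k' l'
        unfolding bool_group_16_def monoid.simps prod.case prod.inject by argo
      then show "?f \<in> hom ?H ?H" by (auto simp: hom_def bool_group_16_def)
      show "x = \<one>\<^bsub>?H\<^esub>" if "?f x = \<one>\<^bsub>?H\<^esub>" for x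
        using that by (cases x) (auto simp: bool_group_16_def)
      have "?f (True, False, False, False) \<noteq> (True, False, False, False)" by simp
      then show "\<exists>x\<in>carrier ?H. ?f x \<noteq> x" unfolding bool_group_16_def partial_object.simps by blast
    qed
    then show ?thesis unfolding Bex_def split_paired_Ex prod.case by blast
  qed
  note inv[of True False False False, simplified] inv[of True False False True, simplified]
    inv[of False True False False, simplified] inv[of False True True False, simplified]
    inv[of False False False False, simplified] inv[of False False False True, simplified]
    inv[of False False True False, simplified] inv[of False False True True, simplified]
    inv[of True True False False, simplified] inv[of True True False True, simplified]
    inv[of True True True False, simplified] inv[of True True True True, simplified]
  moreover note shift[of False False True True, unfolded ex_bool_eq, simplified]
    shift[of True True False False, unfolded ex_bool_eq, simplified]
    shift[of False True False False, unfolded ex_bool_eq, simplified]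
    shift[of False False True False, unfolded ex_bool_eq, simplified]
    swap[of False True True False, unfolded ex_bool_eq, simplified]
    swap[of False False False False, unfolded ex_bool_eq, simplified]
    swap[of True True True True, unfolded ex_bool_eq, simplified]
    swap[of True False False True, unfolded ex_bool_eq, simplified]
  ultimately show False by (smt (verit))
qed

text \<open>The hypotheses give \<open>a \<otimes> b \<otimes> a = inv b\<close>, so
  \<open>a\<close> inverts the cyclic group of \<open>b\<close>, which serves as the abelian
  subgroup. Its index is 2 because it and its coset of \<open>a\<close> together are closed under
  left multiplication by both generators.\<close>

lemma (in noncyclic_pair) generalized_dihedral_if_involutions:
  assumes aa: "a \<otimes> a = \<one>" and abab: "a \<otimes> b \<otimes> (a \<otimes> b) = \<one>"
  shows "generalized_dihedral G"
proof -
  let ?A = "generate G {b}"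
  have A: "subgroup ?A G" by (rule powers_subgroups(2))
  have Ac: "x \<in> carrier G" if "x \<in> ?A" for x using that A subgroup.mem_carrier by metis
  have comm: "x \<otimes> y = y \<otimes> x" if "x \<in> ?A" "y \<in> ?A" for x y
  proof -
    obtain i j :: int where "x = b [^] i" "y = b [^] j"
      using \<open>x \<in> ?A\<close> \<open>y \<in> ?A\<close> by (auto simp: generate_pow)
    then show ?thesis by (simp add: int_pow_mult[symmetric] add.commute)
  qed
  have inva: "inv a = a" using aa by (simp add: inv_equality)
  have aax: "a \<otimes> (a \<otimes> x) = x" if "x \<in> carrier G" for x using aa that by (simp flip: m_assoc)
  have aba: "a \<otimes> b \<otimes> a = inv b"
    using abab by (intro inv_equality[symmetric]) (simp_all add: m_assoc)
  have inverts: "a \<otimes> x \<otimes> a = inv x" if "x \<in> ?A" for x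
    using that
  proof induction
    case one
    then show ?case by (simp add: aa)
  next
    case (incl h)
    then show ?case by (simp add: aba)
  next
    case (inv h)
    then have h: "h = b" by simp
    have "a \<otimes> (a \<otimes> b \<otimes> a) \<otimes> a = b" by (simp add: m_assoc aax aa)
    then show ?case by (simp add: h aba)
  next
    case (eng h1 h2)
    have c: "h1 \<in> carrier G" "h2 \<in> carrier G" using eng Ac by auto
    have "a \<otimes> (h1 \<otimes> h2) \<otimes> a = (a \<otimes> h1 \<otimes> a) \<otimes> (a \<otimes> h2 \<otimes> a)"
      using c by (simp add: m_assoc aax)
    also have "\<dots> = inv (h2 \<otimes> h1)" using eng c by (simp add: inv_mult_group)
    finally show ?case using comm[OF eng.hyps] by simp
  qed
  have cosets: "x \<in> ?A \<or> x \<in> ?A #> a" if x: "x \<in> generate G {a, b}" for x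
  proof -
    have ab: "{a, b} \<subseteq> carrier G" by simp
    from x ab fin show ?thesis
    proof (induction rule: generate_left_induct)
      case one
      then show ?case by (simp add: mem_powers)
    next
      case (mult s x)
      consider "x \<in> ?A" | h where "h \<in> ?A" "x = h \<otimes> a"
        using mult(3) by (auto simp: r_coset_def)
      then show ?case
      proof cases
        case 1
        then have "a \<otimes> x = inv x \<otimes> a"
          using Ac[OF 1] inverts[OF 1] by (simp add: m_assoc aa flip: inverts)
        moreover have "inv x \<in> ?A" using 1 A by (simp add: subgroup.m_inv_closed)
        moreover have "b \<otimes> x \<in> ?A" using 1 A by (simp add: subgroup.m_closed mem_powers)
        ultimately show ?thesis using mult(1) by (auto simp: r_coset_def)
      next
        case 2
        then have "a \<otimes> x \<in> ?A"
          using Ac[OF 2(1)] inverts[OF 2(1)] A by (simp add: subgroup.m_inv_closed flip: m_assoc)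
        moreover have "b \<otimes> x = (b \<otimes> h) \<otimes> a" using Ac[OF 2(1)] 2(2) by (simp add: m_assoc)
        moreover have "b \<otimes> h \<in> ?A" using 2 A by (simp add: subgroup.m_closed mem_powers)
        ultimately show ?thesis using mult(1) by (auto simp: r_coset_def)
      qed
    qed
  qed
  have "rcosets ?A = {?A, ?A #> a}"
  proof
    show "rcosets ?A \<subseteq> {?A, ?A #> a}"
    proof
      fix C assume "C \<in> rcosets ?A"
      then obtain x where x: "x \<in> carrier G" "C = ?A #> x" by (auto simp: RCOSETS_def)
      then show "C \<in> {?A, ?A #> a}"
        using cosets[of x] gen coset_join2[OF x(1) A] repr_independence[OF _ a A, of x] by auto
    qed
    have "?A #> \<one> = ?A" using A by (simp add: subgroup.subset coset_mult_one)
    then show "{?A, ?A #> a} \<subseteq> rcosets ?A"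
      unfolding RCOSETS_def using a one_closed by blast
  qed
  moreover have "?A \<noteq> ?A #> a"
    using rcos_self[OF a A] not_mem_powers(1) by auto
  ultimately have "card (rcosets ?A) = 2" by simp
  moreover have "comm_group (G\<lparr>carrier := ?A\<rparr>)"
    using comm by (intro group.group_comm_groupI subgroup_imp_group A) auto
  ultimately show ?thesis
    unfolding generalized_dihedral_def using A aa inverts not_mem_powers(1)
    by (intro exI[of _ ?A] exI[of _ a]) auto
qed

text \<open>Every element outside \<open>A\<close> squares to \<open>\<one>\<close>, so an
  admissible \<open>S\<close> lies in \<open>A\<close>. No arc joins the two cosets of
  \<open>A\<close> then, and they can be moved independently.\<close>

lemma (in group) generalized_dihedral_not_admits_ORR:
  assumes "generalized_dihedral G" and noncyclic: "\<And>x. x \<in> carrier G \<Longrightarrow> generate G {x} \<noteq> carrier G"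
  shows "\<not> admits_ORR G"
proof
  obtain A t where A: "subgroup A G" and card: "card (rcosets A) = 2" and t: "t \<in> carrier G" "t \<notin> A"
    and tt: "t \<otimes> t = \<one>" and inverts: "\<And>a. a \<in> A \<Longrightarrow> t \<otimes> a \<otimes> t = inv a"
    using assms(1) unfolding generalized_dihedral_def by blast
  have Ac: "x \<in> carrier G" if "x \<in> A" for x using that A subgroup.mem_carrier by metis
  have "A #> \<one> = A" using A by (simp add: subgroup.subset coset_mult_one)
  then have "{A, A #> t} \<subseteq> rcosets A" unfolding RCOSETS_def using t by (auto intro: bexI[of _ \<one>])
  moreover have "A \<noteq> A #> t" using rcos_self[OF t(1) A] t(2) by auto
  moreover have "finite (rcosets A)" using card card.infinite by fastforce
  ultimately have rcosets: "rcosets A = {A, A #> t}"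
    using card_subset_eq[of "rcosets A" "{A, A #> t}"] card by simp
  have outside: "\<exists>a\<in>A. x = a \<otimes> t" if x: "x \<in> carrier G" "x \<notin> A" for x
  proof -
    have "A #> x \<in> {A, A #> t}" using x unfolding rcosets[symmetric] by (auto simp: RCOSETS_def)
    then have "x \<in> A #> t" using rcos_self[OF x(1) A] x(2) by auto
    then show ?thesis by (auto simp: r_coset_def)
  qed
  \<comment> \<open>For trivial \<open>A\<close> the group would be \<open>{\<one>, t}\<close>,
    which is cyclic.\<close>
  have "\<exists>a\<in>A. a \<noteq> \<one>"
  proof (rule ccontr)
    assume "\<not> ?thesis"
    then have "carrier G \<subseteq> {\<one>, t}" using outside t by fastforce
    also have "\<dots> \<subseteq> generate G {t}" by (simp add: generate.one generate.incl)
    finally show False using noncyclic[OF t(1)] generate_incl[of "{t}"] t by auto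
  qed
  then obtain a where a: "a \<in> A" "a \<noteq> \<one>" by blast
  have ac: "a \<in> carrier G" using a Ac by simp
  assume "admits_ORR G"
  then obtain S where S: "S \<subseteq> carrier G" "S \<inter> m_inv G ` S = {}"
    and eq: "digraph_automorphisms (cayley_digraph G S) = right_regular_rep G"
    by (auto simp: admits_ORR_def)
  have SA: "S \<subseteq> A"
  proof
    fix x assume x: "x \<in> S"
    show "x \<in> A"
    proof (rule ccontr)
      assume "x \<notin> A"
      then obtain u where u: "u \<in> A" "x = u \<otimes> t" using outside S x by blast
      then have "x \<otimes> x = u \<otimes> (t \<otimes> u \<otimes> t)" using Ac t by (simp add: m_assoc)
      also have "\<dots> = \<one>" using inverts u Ac by simp
      finally have "inv x = x" using inv_equality[of x x] S x by auto
      then show False using S x by force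
    qed
  qed
  \<comment> \<open>Translating only \<open>A\<close> moves \<open>\<one>\<close> and fixes
    \<open>t\<close>, which no right translation does.\<close>
  define f where "f = (\<lambda>x\<in>carrier G. if x \<in> A then x \<otimes> a else x)"
  have fA: "f x \<in> A \<longleftrightarrow> x \<in> A" if "x \<in> carrier G" for x
    using that subgroup_mult_mem_iff(2)[OF A a(1)] by (simp add: f_def)
  have "f \<in> digraph_automorphisms (cayley_digraph G S)"
  proof -
    have "bij_betw f (carrier G) (carrier G)"
      by (rule bij_betwI[where g = "\<lambda>x. if x \<in> A then x \<otimes> inv a else x"])
        (use a ac A in \<open>auto simp: f_def m_assoc subgroup_mult_mem_iff subgroup.m_inv_closed\<close>)
    then have "f \<in> Bij (carrier G)" by (simp add: Bij_def f_def)
    moreover have "f x \<in> carrier G" if "x \<in> carrier G" for x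
      using that ac by (simp add: f_def)
    moreover have "y \<otimes> inv x \<in> S \<longleftrightarrow> f y \<otimes> inv (f x) \<in> S" if xy: "x \<in> carrier G" "y \<in> carrier G" for x y
    proof -
      have iff: "y \<in> A \<longleftrightarrow> x \<in> A" if "y \<otimes> inv x \<in> A" "x \<in> carrier G" "y \<in> carrier G" for x y
        using subgroup_mult_mem_iff(1)[OF A that(1), of x] that by (simp add: m_assoc)
      have cancel: "y \<otimes> a \<otimes> inv (x \<otimes> a) = y \<otimes> inv x"
        using xy ac by (simp add: inv_mult_group m_assoc flip: m_assoc[of a "inv a"])
      have fc: "f x \<in> carrier G" "f y \<in> carrier G" using xy ac by (simp_all add: f_def)
      show ?thesis
      proof (cases "y \<in> A \<longleftrightarrow> x \<in> A")
        case True
        then show ?thesis using xy cancel by (simp add: f_def)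
      next
        case False
        then show ?thesis using iff[OF _ xy] iff[OF _ fc] fA xy SA by blast
      qed
    qed
    ultimately show ?thesis by (simp add: digraph_automorphisms_def cayley_digraph_def)
  qed
  then obtain g where g: "g \<in> carrier G" "f = (\<lambda>x\<in>carrier G. x \<otimes> g)"
    unfolding eq right_regular_rep_def by auto
  have "f \<one> = a" using A ac by (simp add: f_def subgroup.one_closed)
  moreover have "f \<one> = g" using g by simp
  moreover have "f t = t" using t by (simp add: f_def)
  moreover have "f t = t \<otimes> g" using g(2) t by simp
  ultimately show False using a t ac by simp
qed

section \<open>The presented group of order 16\<close>

definition word_value :: "('a, 'b) monoid_scheme \<Rightarrow> ('g \<Rightarrow> 'a) \<Rightarrow> ('g \<times> bool) list \<Rightarrow> 'a" where
  "word_value M g w = foldr (\<lambda>(x, e) v. (if e then g x else inv\<^bsub>M\<^esub> g x) \<otimes>\<^bsub>M\<^esub> v) w \<one>\<^bsub>M\<^esub>"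

section \<open>Evaluation of words and the universal property of the free group\<close>

context group
begin

lemma word_value_closed: "\<forall>x. g x \<in> carrier G \<Longrightarrow> word_value G g w \<in> carrier G"
  by (induction w) (auto simp: word_value_def)

lemma word_value_append:
  assumes "\<forall>x. g x \<in> carrier G"
  shows "word_value G g (u @ v) = word_value G g u \<otimes> word_value G g v"
proof (induction u)
  case Nil
  then show ?case using word_value_closed[OF assms] by (simp add: word_value_def[of _ _ "[]"])
next
  case (Cons c u)
  have Cons_value: "word_value G g (c # w) = (if snd c then g (fst c) else inv g (fst c)) \<otimes> word_value G g w" for w
    by (simp add: word_value_def split: prod.split)
  show ?case using Cons word_value_closed[OF assms] assms by (auto simp: Cons_value m_assoc)
qed

lemma word_value_free_eq:
  assumes "free_eq u v" and g: "\<forall>x. g x \<in> carrier G"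
  shows "word_value G g u = word_value G g v"
  using assms(1)
proof induction
  case (cancel u x e v)
  have "word_value G g [(x, e), (x, \<not> e)] = \<one>" using g by (auto simp: word_value_def)
  then show ?case using word_value_closed[OF g] by (simp only: word_value_append[OF g] l_one)
qed simp_all

text \<open>Evaluation of words is constant on classes, so the homomorphism may evaluate an
  arbitrarily chosen representative.\<close>

lemma free_group_universal:
  assumes g: "\<forall>x. g x \<in> carrier G"
  obtains \<phi> where "\<phi> \<in> hom free_group G" "\<And>x. \<phi> (free_gen x) = g x"
proof
  let ?\<phi> = "\<lambda>U. word_value G g (SOME u. u \<in> U)"
  have value_class: "?\<phi> (free_class u) = word_value G g u" for u
  proof -
    have "u \<in> free_class u" by (simp add: free_class_def free_eq.refl)
    then have "(SOME v. v \<in> free_class u) \<in> free_class u" by (rule someI)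
    then show ?thesis using word_value_free_eq[OF _ g] by (simp add: free_class_def)
  qed
  show "?\<phi> \<in> hom free_group G"
  proof (rule homI)
    show "?\<phi> U \<in> carrier G" for U by (rule word_value_closed[OF g])
    fix U V :: "('c \<times> bool) list set"
    assume "U \<in> carrier free_group" "V \<in> carrier free_group"
    then obtain u v where "U = free_class u" "V = free_class v" by (auto simp: free_group_def)
    then show "?\<phi> (U \<otimes>\<^bsub>free_group\<^esub> V) = ?\<phi> U \<otimes> ?\<phi> V"
      by (simp only: free_group_mult value_class word_value_append[OF g])
  qed
  show "?\<phi> (free_gen x) = g x" for x
    unfolding free_gen_def value_class using g by (auto simp: word_value_def)
qed

end

lemma generate_free_group: "generate free_group (range free_gen) = carrier free_group"
proof
  interpret group "free_group :: ('g \<times> bool) list set monoid" by (rule group_free_group)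
  have gens: "range free_gen \<subseteq> carrier (free_group :: ('g \<times> bool) list set monoid)"
    by (auto simp: free_gen_def free_group_def)
  then show "generate free_group (range free_gen) \<subseteq> carrier (free_group :: ('g \<times> bool) list set monoid)"
    by (rule generate_incl)
  have letter: "free_class [(x, e)] \<in> generate free_group (range free_gen)" for x :: 'g and e
  proof (cases e)
    case True
    then show ?thesis by (simp add: generate.incl flip: free_gen_def)
  next
    case False
    have "inv\<^bsub>free_group\<^esub> (free_gen x) = free_class [(x, False)]"
    proof (rule inv_equality)
      show "free_class [(x, False)] \<otimes>\<^bsub>free_group\<^esub> free_gen x = \<one>\<^bsub>free_group\<^esub>"
        using free_eq.cancel[of "[]" x False "[]"]
        by (simp add: free_gen_def free_group_mult free_class_eq_iff) (simp add: free_group_def free_class_eq_iff)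
    qed (auto simp: free_gen_def free_group_def)
    then show ?thesis using False by (metis generate.inv rangeI)
  qed
  have "free_class u \<in> generate free_group (range free_gen)" for u :: "('g \<times> bool) list"
  proof (induction u)
    case Nil
    have "\<one>\<^bsub>free_group\<^esub> = free_class ([] :: ('g \<times> bool) list)" by (simp add: free_group_def)
    then show ?case by (metis generate.one)
  next
    case (Cons c u)
    have "free_class (c # u) = free_class [(fst c, snd c)] \<otimes>\<^bsub>free_group\<^esub> free_class u"
      by (simp add: free_group_mult)
    then show ?case using generate.eng[OF letter Cons] by metis
  qed
  then show "carrier (free_group :: ('g \<times> bool) list set monoid) \<subseteq> generate free_group (range free_gen)"
    by (auto simp: free_group_def)
qed

text \<open>The relations hold in the quotient, so \<open>iso_bool_group_16\<close> applies once the
  squares of the generators are seen to be nontrivial and distinct there. For this the free group is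
  mapped to the model: the map kills the relators, hence \<open>N\<close>, but not
  \<open>a^2\<close>, \<open>b^2\<close> or \<open>a^2 b^2\<close>.\<close>

lemma exceptional_group_16_iso_bool_group_16: "exceptional_group_16 \<cong> bool_group_16"
proof -
  let ?F = "free_group :: (two_gens \<times> bool) list set monoid"
  interpret F: group ?F by (rule group_free_group)
  interpret M: group bool_group_16 by (rule group_bool_group_16)
  define a where "a = free_gen gen_a"
  define b where "b = free_gen gen_b"
  define R where "R = {a [^]\<^bsub>?F\<^esub> (4::nat), b [^]\<^bsub>?F\<^esub> (4::nat),
           (a \<otimes>\<^bsub>?F\<^esub> b) [^]\<^bsub>?F\<^esub> (2::nat), (a \<otimes>\<^bsub>?F\<^esub> inv\<^bsub>?F\<^esub> b) [^]\<^bsub>?F\<^esub> (2::nat)}"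
  define N where "N = normal_closure ?F R"
  define E where "E = ?F Mod N"
  have exceptional: "exceptional_group_16 = E"
    by (simp add: E_def exceptional_group_16_def presented_group_def Let_def N_def R_def a_def b_def)
  have ab [simp]: "a \<in> carrier ?F" "b \<in> carrier ?F"
    by (simp_all add: a_def b_def free_gen_def free_group_def)
  have RF: "R \<subseteq> carrier ?F" by (auto simp: R_def)
  have N: "N \<lhd> ?F" unfolding N_def by (rule F.normal_closure_normal[OF RF])
  interpret N: normal N ?F by (rule N)
  have RN: "R \<subseteq> N" unfolding N_def normal_closure_def by blast
  define \<pi> where "\<pi> = (\<lambda>x. N #>\<^bsub>?F\<^esub> x)"
  interpret \<pi>: group_hom ?F "E" \<pi>
    using N.r_coset_hom_Mod N.factorgroup_is_group by (simp add: E_def \<pi>_def group_hom_def group_hom_axioms_def F.group_axioms)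
  have \<pi>_one: "\<pi> x = \<one>\<^bsub>E\<^esub> \<longleftrightarrow> x \<in> N" if "x \<in> carrier ?F" for x
    using that F.coset_join1[OF _ that N.is_subgroup] F.coset_join2[OF that N.is_subgroup] by (auto simp: E_def \<pi>_def FactGroup_def)
  define g where "g x = (case x of gen_a \<Rightarrow> (True, False, False, False) | gen_b \<Rightarrow> (False, True, False, False))" for x
  have "\<forall>x. g x \<in> carrier bool_group_16" by (simp add: bool_group_16_def)
  then obtain \<phi> where \<phi>: "\<phi> \<in> hom ?F bool_group_16" and \<phi>g: "\<And>x. \<phi> (free_gen x) = g x"
    by (rule M.free_group_universal) blast
  interpret \<phi>: group_hom ?F bool_group_16 \<phi>
    using \<phi> by (simp add: group_hom_def group_hom_axioms_def F.group_axioms M.group_axioms)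
  have \<phi>a: "\<phi> a = (True, False, False, False)" and \<phi>b: "\<phi> b = (False, True, False, False)"
    by (simp_all add: a_def b_def \<phi>g g_def)
  have Minv: "inv\<^bsub>bool_group_16\<^esub> (False, True, False, False) = (False, True, False, True)"
    by (rule M.inv_equality) (simp_all add: bool_group_16_def)
  have "R \<subseteq> kernel ?F bool_group_16 \<phi>"
    using RF by (auto simp: kernel_def R_def \<phi>.hom_nat_pow \<phi>a \<phi>b Minv numeral_eq_Suc) (simp_all add: bool_group_16_def)
  then have "N \<subseteq> kernel ?F bool_group_16 \<phi>"
    unfolding N_def normal_closure_def using \<phi>.normal_kernel by blast
  then have \<phi>N: "\<phi> x = \<one>\<^bsub>bool_group_16\<^esub>" if "x \<in> N" for x using that by (auto simp: kernel_def)
  have "E \<cong> bool_group_16"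
  proof (rule \<pi>.H.iso_bool_group_16)
    show "\<pi> a \<in> carrier (E)" "\<pi> b \<in> carrier (E)" by simp_all
    have "generate (E) (\<pi> ` range free_gen) = \<pi> ` generate ?F (range free_gen)"
      by (rule \<pi>.generate_img) (auto simp: free_gen_def free_group_def)
    also have "\<dots> = carrier (E)"
      unfolding generate_free_group by (auto simp: E_def \<pi>_def FactGroup_def RCOSETS_def)
    also have "range free_gen = {a, b}"
    proof -
      have UNIV: "UNIV = {gen_a, gen_b}" using two_gens.exhaust by blast
      show ?thesis unfolding a_def b_def UNIV by simp
    qed
    finally show "generate (E) {\<pi> a, \<pi> b} = carrier (E)" by simp
    have rel: "\<pi> x = \<one>\<^bsub>E\<^esub>" if "x \<in> R" for x using that RN RF \<pi>_one by blast
    show "\<pi> a \<otimes>\<^bsub>E\<^esub> \<pi> a \<otimes>\<^bsub>E\<^esub> (\<pi> a \<otimes>\<^bsub>E\<^esub> \<pi> a) = \<one>\<^bsub>E\<^esub>"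
      using rel[of "a [^]\<^bsub>?F\<^esub> (4::nat)"] by (simp add: R_def numeral_eq_Suc \<pi>.H.m_assoc)
    show "\<pi> b \<otimes>\<^bsub>E\<^esub> \<pi> b \<otimes>\<^bsub>E\<^esub> (\<pi> b \<otimes>\<^bsub>E\<^esub> \<pi> b) = \<one>\<^bsub>E\<^esub>"
      using rel[of "b [^]\<^bsub>?F\<^esub> (4::nat)"] by (simp add: R_def numeral_eq_Suc \<pi>.H.m_assoc)
    show "\<pi> a \<otimes>\<^bsub>E\<^esub> \<pi> b \<otimes>\<^bsub>E\<^esub> (\<pi> a \<otimes>\<^bsub>E\<^esub> \<pi> b) = \<one>\<^bsub>E\<^esub>"
      using rel[of "(a \<otimes>\<^bsub>?F\<^esub> b) [^]\<^bsub>?F\<^esub> (2::nat)"] by (simp add: R_def numeral_eq_Suc)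
    show "\<pi> a \<otimes>\<^bsub>E\<^esub> inv\<^bsub>E\<^esub> \<pi> b \<otimes>\<^bsub>E\<^esub> (\<pi> a \<otimes>\<^bsub>E\<^esub> inv\<^bsub>E\<^esub> \<pi> b) = \<one>\<^bsub>E\<^esub>"
      using rel[of "(a \<otimes>\<^bsub>?F\<^esub> inv\<^bsub>?F\<^esub> b) [^]\<^bsub>?F\<^esub> (2::nat)"] by (simp add: R_def numeral_eq_Suc)
    have nontriv: "x \<notin> N" if "\<phi> x \<noteq> \<one>\<^bsub>bool_group_16\<^esub>" for x using \<phi>N that by blast
    have "a \<otimes>\<^bsub>?F\<^esub> a \<notin> N" "b \<otimes>\<^bsub>?F\<^esub> b \<notin> N" "a \<otimes>\<^bsub>?F\<^esub> a \<otimes>\<^bsub>?F\<^esub> (b \<otimes>\<^bsub>?F\<^esub> b) \<notin> N"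
      by (rule nontriv; simp add: \<phi>a \<phi>b; simp add: bool_group_16_def)+
    then have ne: "\<pi> (a \<otimes>\<^bsub>?F\<^esub> a) \<noteq> \<one>\<^bsub>E\<^esub>" "\<pi> (b \<otimes>\<^bsub>?F\<^esub> b) \<noteq> \<one>\<^bsub>E\<^esub>"
      "\<pi> (a \<otimes>\<^bsub>?F\<^esub> a \<otimes>\<^bsub>?F\<^esub> (b \<otimes>\<^bsub>?F\<^esub> b)) \<noteq> \<one>\<^bsub>E\<^esub>"
      by (simp_all only: \<pi>_one ab F.m_closed not_False_eq_True)
    then show "\<pi> a \<otimes>\<^bsub>E\<^esub> \<pi> a \<noteq> \<one>\<^bsub>E\<^esub>" "\<pi> b \<otimes>\<^bsub>E\<^esub> \<pi> b \<noteq> \<one>\<^bsub>E\<^esub>"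
      by simp_all
    \<comment> \<open>If the squares agreed, \<open>a^2 b^2\<close> would have the same image as the
      relator \<open>b^4\<close>.\<close>
    show "\<pi> a \<otimes>\<^bsub>E\<^esub> \<pi> a \<noteq> \<pi> b \<otimes>\<^bsub>E\<^esub> \<pi> b"
    proof
      assume "\<pi> a \<otimes>\<^bsub>E\<^esub> \<pi> a = \<pi> b \<otimes>\<^bsub>E\<^esub> \<pi> b"
      then have "\<pi> (a \<otimes>\<^bsub>?F\<^esub> a \<otimes>\<^bsub>?F\<^esub> (b \<otimes>\<^bsub>?F\<^esub> b)) = \<pi> b \<otimes>\<^bsub>E\<^esub> \<pi> b \<otimes>\<^bsub>E\<^esub> (\<pi> b \<otimes>\<^bsub>E\<^esub> \<pi> b)"
        by simp
      also have "\<dots> = \<one>\<^bsub>E\<^esub>"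
        using rel[of "b [^]\<^bsub>?F\<^esub> (4::nat)"] by (simp add: R_def numeral_eq_Suc \<pi>.H.m_assoc)
      finally show False using ne(3) by blast
    qed
  qed
  then show ?thesis by (simp only: exceptional)
qed

lemma order_exceptional_group_16: "order exceptional_group_16 = 16"
proof -
  have "card (UNIV :: (bool \<times> bool \<times> bool \<times> bool) set) = 16"
    by (simp add: card_cartesian_product flip: UNIV_Times_UNIV)
  then show ?thesis
    using iso_same_card[OF exceptional_group_16_iso_bool_group_16] by (simp add: order_def bool_group_16_def)
qed

section \<open>Classification\<close>

context noncyclic_pair
begin

lemma pair_mult_right: "noncyclic_pair G a (b \<otimes> a)"
  by (rule noncyclic_pair.swapped[OF noncyclic_pair.pair_mult[OF swapped]])

text \<open>Only equal squares of \<open>a\<close> and \<open>b\<close> obstruct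
  \<open>admits_ORR_two_and_square\<close>. In that case \<open>b\<close> is replaced by
  \<open>b \<otimes> a\<close>, whose square is \<open>a^4\<close>, different from both
  \<open>\<one>\<close> and \<open>a^2\<close>.\<close>

lemma admits_ORR_abelian_order_ge_5:
  assumes comm: "b \<otimes> a = a \<otimes> b"
    and "a \<otimes> a \<noteq> \<one>" "a \<otimes> a \<otimes> a \<noteq> \<one>" "a \<otimes> a \<otimes> (a \<otimes> a) \<noteq> \<one>" "b \<otimes> b \<noteq> \<one>"
  shows "admits_ORR G"
proof (cases "a \<otimes> a = b \<otimes> b")
  case True
  interpret q: noncyclic_pair G a "b \<otimes> a" by (rule pair_mult_right)
  have "b \<otimes> a \<otimes> (b \<otimes> a) = b \<otimes> (a \<otimes> b) \<otimes> a" by (simp add: m_assoc)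
  also have "\<dots> = b \<otimes> b \<otimes> (a \<otimes> a)" by (simp add: m_assoc flip: comm)
  finally have "b \<otimes> a \<otimes> (b \<otimes> a) = a \<otimes> a \<otimes> (a \<otimes> a)" by (simp only: True)
  then show ?thesis using assms by (intro q.admits_ORR_two_and_square) auto
qed (use assms in \<open>auto intro: admits_ORR_two_and_square\<close>)

lemma classify_abelian:
  assumes comm: "b \<otimes> a = a \<otimes> b" and a2: "a \<otimes> a \<noteq> \<one>" and b2: "b \<otimes> b \<noteq> \<one>"
  shows "admits_ORR G \<or> G \<cong> integer_mod_group 3 \<times>\<times> integer_mod_group 3
    \<or> G \<cong> integer_mod_group 4 \<times>\<times> integer_mod_group 2"
proof -
  have pows: "x [^] (2::int) = x \<otimes> x" "x [^] (3::int) = x \<otimes> x \<otimes> x" "x [^] (4::int) = x \<otimes> x \<otimes> (x \<otimes> x)"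
    if "x \<in> carrier G" for x
    using int_pow_mult[of x 1 1] int_pow_mult[of x 2 1] int_pow_mult[of x 2 2] that by simp_all
  \<comment> \<open>For \<open>x\<close> of order 3 and \<open>y\<close> of order 4 the product has
    order 12, so the pair \<open>x \<otimes> y\<close>, \<open>y\<close> falls under the case of
    order at least 5.\<close>
  have orders_3_4: "admits_ORR G"
    if "noncyclic_pair G x y" "y \<otimes> x = x \<otimes> y" "x \<otimes> x \<otimes> x = \<one>" "y \<otimes> y \<otimes> (y \<otimes> y) = \<one>" "y \<otimes> y \<noteq> \<one>"
    for x y
  proof -
    interpret p: noncyclic_pair G x y by (rule that(1))
    interpret q: noncyclic_pair G "x \<otimes> y" y by (rule p.pair_mult)
    have x3: "x \<otimes> (x \<otimes> x) = \<one>" and y4: "y \<otimes> (y \<otimes> (y \<otimes> y)) = \<one>" using that by (simp_all add: m_assoc)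
    have x3': "x \<otimes> (x \<otimes> (x \<otimes> z)) = z" if "z \<in> carrier G" for z
      using x3 that by (metis p.a l_one m_assoc m_closed)
    have yx': "y \<otimes> (x \<otimes> z) = x \<otimes> (y \<otimes> z)" if "z \<in> carrier G" for z
      using \<open>y \<otimes> x = x \<otimes> y\<close> that by (metis p.a p.b m_assoc)
    note nf = m_assoc \<open>y \<otimes> x = x \<otimes> y\<close> yx' x3 x3' y4
    have "x \<noteq> \<one>" "y \<noteq> \<one>" using p.mem_powers p.not_mem_powers by metis+
    show ?thesis
    proof (rule q.admits_ORR_abelian_order_ge_5)
      show "x \<otimes> y \<otimes> (x \<otimes> y) \<noteq> \<one>"
      proof
        assume "x \<otimes> y \<otimes> (x \<otimes> y) = \<one>"
        then have "x \<otimes> x \<otimes> (y \<otimes> y) \<in> generate G {y}" by (simp add: nf p.mem_powers)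
        then have "x \<otimes> x \<in> generate G {y}" by (simp add: p.powers_mult_mem_iff p.mem_powers)
        then have "x \<otimes> x \<otimes> (x \<otimes> x) \<in> generate G {y}" using generate.eng by metis
        then show False using p.not_mem_powers by (simp add: nf)
      qed
      have "y \<otimes> (y \<otimes> y) \<noteq> \<one>" using y4 \<open>y \<noteq> \<one>\<close> by auto
      then show "x \<otimes> y \<otimes> (x \<otimes> y) \<otimes> (x \<otimes> y) \<noteq> \<one>" by (simp add: nf)
      show "x \<otimes> y \<otimes> (x \<otimes> y) \<otimes> (x \<otimes> y \<otimes> (x \<otimes> y)) \<noteq> \<one>" using \<open>x \<noteq> \<one>\<close> by (simp add: nf)
    qed (use that in \<open>simp_all add: nf\<close>)
  qed
  \<comment> \<open>Each generator has order 3, order 4 or order at least 5.\<close>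
  consider "a \<otimes> a \<otimes> a \<noteq> \<one>" "a \<otimes> a \<otimes> (a \<otimes> a) \<noteq> \<one>" | "b \<otimes> b \<otimes> b \<noteq> \<one>" "b \<otimes> b \<otimes> (b \<otimes> b) \<noteq> \<one>"
    | "a \<otimes> a \<otimes> a = \<one>" "b \<otimes> b \<otimes> (b \<otimes> b) = \<one>" | "b \<otimes> b \<otimes> b = \<one>" "a \<otimes> a \<otimes> (a \<otimes> a) = \<one>"
    | (c33) "a \<otimes> a \<otimes> a = \<one>" "b \<otimes> b \<otimes> b = \<one>"
    | (c44) "a \<otimes> a \<otimes> (a \<otimes> a) = \<one>" "b \<otimes> b \<otimes> (b \<otimes> b) = \<one>"
    by blast
  then show ?thesis
  proof cases
    case 1
    then show ?thesis using admits_ORR_abelian_order_ge_5[OF comm a2] b2 by blast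
  next
    case 2
    then show ?thesis
      using noncyclic_pair.admits_ORR_abelian_order_ge_5[OF swapped comm[symmetric] b2] a2 by blast
  next
    case 3
    then show ?thesis using orders_3_4[OF noncyclic_pair_axioms comm] b2 by blast
  next
    case 4
    then show ?thesis using orders_3_4[OF swapped comm[symmetric]] a2 by blast
  next
    case c33
    have "G \<cong> integer_mod_group 3 \<times>\<times> integer_mod_group 3"
    proof (rule iso_product_of_cyclic[OF comm])
      show "a [^] int 3 = \<one>" "b [^] int 3 = \<one>" using c33 by (simp_all add: pows)
      fix i j :: int assume ij: "0 \<le> i" "i < int 3" "0 \<le> j" "j < int 3" and eq: "a [^] i \<otimes> b [^] j = \<one>"
      have "a \<noteq> \<one>" "b \<noteq> \<one>" using a2 b2 by auto
      have "a [^] i \<otimes> b [^] j \<in> generate G {a}" using eq mem_powers by simp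
      moreover have "a [^] i \<in> generate G {a}" by (auto simp: generate_pow)
      ultimately have bj: "b [^] j \<in> generate G {a}" by (simp add: powers_mult_mem_iff)
      have "j \<noteq> 1" using bj not_mem_powers by auto
      \<comment> \<open>If \<open>b^2\<close> were a power of \<open>a\<close>, so would be
        \<open>b^4 = b\<close>.\<close>
      moreover have "j \<noteq> 2"
      proof
        assume "j = 2"
        then have "b \<otimes> b \<in> generate G {a}" using bj by (simp add: pows)
        then have "b \<otimes> b \<otimes> (b \<otimes> b) \<in> generate G {a}" using generate.eng by metis
        moreover have "b \<otimes> b \<otimes> (b \<otimes> b) = b \<otimes> b \<otimes> b \<otimes> b" by (simp add: m_assoc)
        ultimately show False using c33 not_mem_powers by simp
      qed
      ultimately have j: "j = 0" using ij by simp
      then have "a [^] i = \<one>" using eq by simp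
      then have "i \<noteq> 1" "i \<noteq> 2" using \<open>a \<noteq> \<one>\<close> a2 by (auto simp: pows)
      then show "i = 0 \<and> j = 0" using ij j by simp
    qed simp_all
    then show ?thesis by blast
  next
    case c44
    show ?thesis
    proof (cases "a \<otimes> a = b \<otimes> b")
      case True
      \<comment> \<open>Equal squares make \<open>b \<otimes> a\<close> an involution, since its
        square is \<open>b^2 a^2 = b^4\<close>; it generates the factor of order 2.\<close>
      interpret q: noncyclic_pair G a "b \<otimes> a" by (rule pair_mult_right)
      have "b \<otimes> a \<otimes> (b \<otimes> a) = b \<otimes> (a \<otimes> b) \<otimes> a" by (simp add: m_assoc)
      also have "\<dots> = b \<otimes> b \<otimes> (a \<otimes> a)" by (simp add: m_assoc flip: comm)
      finally have t2: "b \<otimes> a \<otimes> (b \<otimes> a) = \<one>" using c44 by (simp only: True)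
      have "G \<cong> integer_mod_group 4 \<times>\<times> integer_mod_group 2"
      proof (rule q.iso_product_of_cyclic)
        show "b \<otimes> a \<otimes> a = a \<otimes> (b \<otimes> a)" by (simp add: comm m_assoc)
        show "a [^] int 4 = \<one>" "(b \<otimes> a) [^] int 2 = \<one>" using c44 t2 by (simp_all add: pows)
        fix i j :: int assume ij: "0 \<le> i" "i < int 4" "0 \<le> j" "j < int 2" and eq: "a [^] i \<otimes> (b \<otimes> a) [^] j = \<one>"
        have "a [^] i \<otimes> (b \<otimes> a) [^] j \<in> generate G {a}" using eq mem_powers by simp
        moreover have "a [^] i \<in> generate G {a}" by (auto simp: generate_pow)
        ultimately have "(b \<otimes> a) [^] j \<in> generate G {a}" by (simp add: q.powers_mult_mem_iff)
        then have "j \<noteq> 1" using q.not_mem_powers by auto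
        then have j: "j = 0" using ij by simp
        then have ai: "a [^] i = \<one>" using eq by simp
        have a1: "a \<noteq> \<one>" using a2 by auto
        then have "a \<otimes> a \<otimes> a \<noteq> \<one>" using c44 by (auto simp flip: m_assoc)
        then have "i \<noteq> 1" "i \<noteq> 2" "i \<noteq> 3" using ai a1 a2 by (auto simp: pows)
        then show "i = 0 \<and> j = 0" using ij j by simp
      qed simp_all
      then show ?thesis by blast
    next
      case False
      have "a \<otimes> (a \<otimes> (b \<otimes> b)) \<noteq> \<one>"
      proof
        assume "a \<otimes> (a \<otimes> (b \<otimes> b)) = \<one>"
        then have "a \<otimes> (a \<otimes> (b \<otimes> b)) \<otimes> (b \<otimes> b) = b \<otimes> b" by simp
        moreover have "a \<otimes> (a \<otimes> (b \<otimes> b)) \<otimes> (b \<otimes> b) = a \<otimes> a \<otimes> (b \<otimes> b \<otimes> (b \<otimes> b))" by (simp add: m_assoc)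
        ultimately show False using c44 False by simp
      qed
      then show ?thesis using admits_ORR_C4_times_C4[OF comm a2 b2] c44 by (simp add: m_assoc)
    qed
  qed
qed

text \<open>The relators express \<open>inv b\<close> both as \<open>aba\<close> and with
  \<open>inv a\<close> in place of \<open>a\<close>, so \<open>a^2 b a^2 = b\<close>. If
  \<open>a^3 = 1\<close>, the second expression becomes \<open>a^2 b a^2\<close> and
  \<open>inv b = b\<close>; if \<open>a^2 = b^2\<close>, then \<open>b^4 = 1\<close> and
  \<open>a\<close> commutes with \<open>b\<close>. The last two conclusions are the hypotheses for
  the swapped pair, to which the lemma is applied again.\<close>

lemma involutory_products_imp:
  assumes noncomm: "a \<otimes> b \<noteq> b \<otimes> a" and b2: "b \<otimes> b \<noteq> \<one>"
    and baba: "b \<otimes> a \<otimes> (b \<otimes> a) = \<one>" and bAbA: "b \<otimes> inv a \<otimes> (b \<otimes> inv a) = \<one>"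
  shows "a \<otimes> a \<otimes> a \<noteq> \<one>" "a \<otimes> a \<noteq> b \<otimes> b"
    "a \<otimes> b \<otimes> (a \<otimes> b) = \<one>" "a \<otimes> inv b \<otimes> (a \<otimes> inv b) = \<one>"
proof -
  have inv_b: "inv b = a \<otimes> b \<otimes> a" "inv b = inv a \<otimes> b \<otimes> inv a"
  proof -
    have l: "inv y = x" if "y \<otimes> x = \<one>" "x \<in> carrier G" "y \<in> carrier G" for x y
      using inv_equality[of y x] that inv_inv by metis
    show "inv b = a \<otimes> b \<otimes> a" "inv b = inv a \<otimes> b \<otimes> inv a"
      using baba bAbA by (intro l; simp add: m_assoc)+
  qed
  have aA: "a \<otimes> (inv a \<otimes> x) = x" "inv a \<otimes> (a \<otimes> x) = x" if "x \<in> carrier G" for x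
    using that by (simp_all flip: m_assoc)
  have "a \<otimes> (a \<otimes> b \<otimes> a) \<otimes> a = a \<otimes> (inv a \<otimes> b \<otimes> inv a) \<otimes> a" using inv_b by simp
  then have zbz: "a \<otimes> a \<otimes> b \<otimes> (a \<otimes> a) = b" by (simp add: m_assoc aA)
  show "a \<otimes> a \<otimes> a \<noteq> \<one>"
  proof
    assume "a \<otimes> a \<otimes> a = \<one>"
    then have "inv a = a \<otimes> a" by (simp add: inv_equality)
    then have "inv b = b" using inv_b(2) zbz by simp
    then show False using b2 by (metis b r_inv)
  qed
  show "a \<otimes> a \<noteq> b \<otimes> b"
  proof
    assume eq: "a \<otimes> a = b \<otimes> b"
    then have bbbb: "b \<otimes> (b \<otimes> b \<otimes> (b \<otimes> b)) = b" using zbz by (simp add: m_assoc)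
    then have "b \<otimes> (b \<otimes> b) \<otimes> b = \<one>" by (simp add: m_assoc)
    then have "inv b = b \<otimes> (b \<otimes> b)" by (simp add: inv_equality)
    then have "a \<otimes> b \<otimes> a = b \<otimes> a \<otimes> a" using inv_b(1) by (simp add: m_assoc eq)
    then show False using noncomm by simp
  qed
  show "a \<otimes> b \<otimes> (a \<otimes> b) = \<one>" using inv_b(1) by (metis a b l_inv m_assoc m_closed)
  have "inv (b \<otimes> inv a \<otimes> (b \<otimes> inv a)) = \<one>" using bAbA by simp
  then show "a \<otimes> inv b \<otimes> (a \<otimes> inv b) = \<one>" by (simp add: inv_mult_group)
qed

lemma classify_nonabelian:
  assumes noncomm: "a \<otimes> b \<noteq> b \<otimes> a" and a2: "a \<otimes> a \<noteq> \<one>" and b2: "b \<otimes> b \<noteq> \<one>"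
  shows "admits_ORR G \<or> G \<cong> quaternion_group \<or> G \<cong> bool_group_16"
proof -
  interpret s: noncyclic_pair G b a by (rule swapped)
  interpret i: noncyclic_pair G "inv a" b by (rule pair_inv)
  have Ab: "inv a \<otimes> b \<noteq> b \<otimes> inv a"
  proof
    assume "inv a \<otimes> b = b \<otimes> inv a"
    then have "a \<otimes> (inv a \<otimes> b) \<otimes> a = a \<otimes> (b \<otimes> inv a) \<otimes> a" by simp
    then have "b \<otimes> a = a \<otimes> b" by (simp add: m_assoc flip: m_assoc[of a "inv a" "b \<otimes> a"])
    then show False using noncomm by simp
  qed
  have A2: "inv a \<otimes> inv a \<noteq> \<one>"
  proof
    assume "inv a \<otimes> inv a = \<one>"
    then have "inv (a \<otimes> a) = \<one>" by (simp add: inv_mult_group)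
    then show False using a2 by (metis a inv_inv inv_one m_closed)
  qed
  consider "b \<otimes> a \<otimes> (b \<otimes> a) \<noteq> \<one>" | "b \<otimes> inv a \<otimes> (b \<otimes> inv a) \<noteq> \<one>"
    | "b \<otimes> a \<otimes> (b \<otimes> a) = \<one>" "b \<otimes> inv a \<otimes> (b \<otimes> inv a) = \<one>" by blast
  then show ?thesis
  proof cases
    case 1
    then show ?thesis
      using admits_ORR_two_and_product[OF a2 b2 1 noncomm] iso_quaternion_group a2 by blast
  next
    case 2
    then show ?thesis
      using i.admits_ORR_two_and_product[OF A2 b2 2 Ab] i.iso_quaternion_group A2 by blast
  next
    case 3
    note c = involutory_products_imp[OF noncomm b2 3]
    note sc = s.involutory_products_imp[OF noncomm[symmetric] a2 c(3,4)]
    show ?thesis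
    proof (cases "a \<otimes> a \<otimes> (a \<otimes> a) = \<one> \<and> b \<otimes> b \<otimes> (b \<otimes> b) = \<one>")
      case True
      then show ?thesis using iso_bool_group_16[OF a b gen _ _ c(3,4) a2 b2 c(2)] by blast
    next
      case False
      \<comment> \<open>One generator has a nontrivial fourth power, hence order at least 5; its
        square joins the connection set.\<close>
      then show ?thesis
        using admits_ORR_two_and_square[OF a2 c(1) _ b2 c(2)] s.admits_ORR_two_and_square[OF b2 sc(1) _ a2 sc(2)] by blast
    qed
  qed
qed

text \<open>If only \<open>a\<close> is an involution, it is replaced by
  \<open>a \<otimes> b\<close>; should that be an involution too, the group is generalized
  dihedral.\<close>

lemma dihedral_or_noninvolution_pair:
  "generalized_dihedral G \<or> (\<exists>x y. noncyclic_pair G x y \<and> x \<otimes> x \<noteq> \<one> \<and> y \<otimes> y \<noteq> \<one>)"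
proof -
  have one_involution: ?thesis if p: "noncyclic_pair G x y" and "x \<otimes> x = \<one>" "y \<otimes> y \<noteq> \<one>" for x y
    using noncyclic_pair.generalized_dihedral_if_involutions[OF p that(2)]
      noncyclic_pair.pair_mult[OF p] that(3) by blast
  show ?thesis
  proof (cases "a \<otimes> a = \<one>"; cases "b \<otimes> b = \<one>")
    assume aa: "a \<otimes> a = \<one>" and bb: "b \<otimes> b = \<one>"
    \<comment> \<open>For two involutions the pair \<open>b\<close>, \<open>a \<otimes> b\<close> is
      used: the product \<open>bab\<close> is conjugate to \<open>a\<close> and so squares to
      \<open>\<one>\<close>.\<close>
    interpret q: noncyclic_pair G b "a \<otimes> b" by (rule noncyclic_pair.swapped[OF pair_mult])
    have "b \<otimes> (a \<otimes> b) \<otimes> (b \<otimes> (a \<otimes> b)) = b \<otimes> (a \<otimes> (b \<otimes> b) \<otimes> a) \<otimes> b" by (simp add: m_assoc)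
    also have "\<dots> = \<one>" by (simp add: aa bb)
    finally show ?thesis using q.generalized_dihedral_if_involutions[OF bb] by blast
  qed (use one_involution[OF noncyclic_pair_axioms] one_involution[OF swapped] noncyclic_pair_axioms in blast)+
qed

end

theorem theorem3p4:
  fixes G :: "('a, 'b) monoid_scheme"
  assumes "group G" and "finite (carrier G)" and "generating_number G = 2"
  shows "let listed =
      G \<cong> integer_mod_group 3 \<times>\<times> integer_mod_group 3 \<or>
      G \<cong> integer_mod_group 4 \<times>\<times> integer_mod_group 2 \<or>
      G \<cong> quaternion_group \<or>
      G \<cong> exceptional_group_16
    in (generalized_dihedral G \<or> admits_ORR G \<or> listed) \<and>
       order exceptional_group_16 = 16 \<and>
       (generalized_dihedral G \<or> listed \<longrightarrow> \<not> admits_ORR G)"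
proof -
  interpret group G by fact
  let ?gen = "\<lambda>n. \<exists>S. S \<subseteq> carrier G \<and> finite S \<and> card S = n \<and> generate G S = carrier G"
  \<comment> \<open>The whole carrier generates, so the \<open>LEAST\<close> in
    \<open>generating_number\<close> is attained.\<close>
  have "?gen (card (carrier G))"
    using assms(2) generate_incl[of "carrier G"] by (intro exI[of _ "carrier G"]) (auto intro: generate.incl)
  then have "?gen 2"
    using LeastI[of ?gen "card (carrier G)"] assms(3) unfolding generating_number_def by simp
  then obtain a b where ab: "{a, b} \<subseteq> carrier G" "generate G {a, b} = carrier G"
    by (auto simp: card_2_iff)
  have noncyclic: "generate G {x} \<noteq> carrier G" if "x \<in> carrier G" for x
  proof
    assume "generate G {x} = carrier G"
    then have "?gen 1" using that by (intro exI[of _ "{x}"]) simp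
    then show False using Least_le[of ?gen 1] assms(3) unfolding generating_number_def by simp
  qed
  have pair: "noncyclic_pair G a b"
    using ab noncyclic assms(2) by unfold_locales auto
  \<comment> \<open>The Boolean model replaces the presented group both in the classification and in
    the converse.\<close>
  have iso_16: "G \<cong> exceptional_group_16 \<longleftrightarrow> G \<cong> bool_group_16"
    using iso_trans[OF _ exceptional_group_16_iso_bool_group_16, of G]
      iso_trans[OF _ group.iso_sym[OF group_exceptional_group_16 exceptional_group_16_iso_bool_group_16], of G]
    by blast
  have "generalized_dihedral G \<or> admits_ORR G \<or>
      G \<cong> integer_mod_group 3 \<times>\<times> integer_mod_group 3 \<or>
      G \<cong> integer_mod_group 4 \<times>\<times> integer_mod_group 2 \<or>
      G \<cong> quaternion_group \<or> G \<cong> exceptional_group_16"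
  proof (rule disjE[OF noncyclic_pair.dihedral_or_noninvolution_pair[OF pair]])
    assume "\<exists>x y. noncyclic_pair G x y \<and> x \<otimes>\<^bsub>G\<^esub> x \<noteq> \<one>\<^bsub>G\<^esub> \<and> y \<otimes>\<^bsub>G\<^esub> y \<noteq> \<one>\<^bsub>G\<^esub>"
    then obtain x y where xy: "noncyclic_pair G x y" "x \<otimes>\<^bsub>G\<^esub> x \<noteq> \<one>\<^bsub>G\<^esub>" "y \<otimes>\<^bsub>G\<^esub> y \<noteq> \<one>\<^bsub>G\<^esub>" by blast
    then show ?thesis
      using noncyclic_pair.classify_abelian[OF xy(1) _ xy(2,3)]
        noncyclic_pair.classify_nonabelian[OF xy(1) _ xy(2,3)] iso_16 by metis
  qed blast
  moreover have "\<not> admits_ORR G" if "generalized_dihedral G"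
    using generalized_dihedral_not_admits_ORR[OF that noncyclic] by blast
  moreover have "\<not> admits_ORR G" if "G \<cong> integer_mod_group 3 \<times>\<times> integer_mod_group 3"
    using not_admits_ORR_if_iso[OF _ that oriented_subsets_symmetric_C3_times_C3] by (simp add: DirProd_group)
  moreover have "\<not> admits_ORR G" if "G \<cong> integer_mod_group 4 \<times>\<times> integer_mod_group 2"
    using not_admits_ORR_if_iso[OF _ that oriented_subsets_symmetric_C4_times_C2] by (simp add: DirProd_group)
  moreover have "\<not> admits_ORR G" if "G \<cong> quaternion_group"
    using not_admits_ORR_if_iso[OF group_quaternion_group that oriented_subsets_symmetric_quaternion_group] .
  moreover have "\<not> admits_ORR G" if "G \<cong> exceptional_group_16"
    using not_admits_ORR_if_iso[OF group_bool_group_16 _ oriented_subsets_symmetric_bool_group_16] that iso_16 by blast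
  ultimately show ?thesis
    unfolding Let_def using order_exceptional_group_16 by blast
qed

end
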